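(* Let $\mathbb{X}$ be a Banach space, $J=[0,T]$, and let $\{\mathrm{A}(t):t\in J\}$ be a family of linear operators on $\mathbb{X}$ satisfying (R1)-(R4) listed in the context, with associated evolution family $\{\mathrm{U}(t,s):0\le s\le t\le T\}$. Define $\mathrm{G}:\mathrm{L}^1(J;\mathbb{X})\to\mathrm{PC}(J;\mathbb{X})$ by $$(\mathrm{G}h)(t):=\int_0^t\mathrm{U}(t,s)h(s)\,\mathrm{d}s,\quad t\in J.$$ If $\{h_n\}_{n\ge1}\subset\mathrm{L}^1(J;\mathbb{X})$ is any integrably bounded sequence, then the sequence $v_n:=\mathrm{G}(h_n)$ is relatively compact (in $\mathrm{PC}(J;\mathbb{X})$).
   Context: $\mathrm{PC}(J;\mathbb{X})$, for fixed points $0<\tau_1<\dots<\tau_m<T$, is the space of functions $x:J\to\mathbb{X}$ continuous on $J\setminus\{\tau_1,\dots,\tau_m\}$ with $x(\tau_k^-)=x(\tau_k)$ and such that $x(\tau_k^+)$ exists for $k=1,\dots,m$, with norm $\|x\|_{\mathrm{PC}}=\sup_{s\in J}\|x(s)\|_{\mathbb{X}}$. A sequence $\{h_n\}\subset\mathrm{L}^1(J;\mathbb{X})$ is integrably bounded if there is $\sigma\in\mathrm{L}^1(J;[0,+\infty))$ with $\|h_n(t)\|_{\mathbb{X}}\le\sigma(t)$ for a.e. $t\in J$ and all $n$. Conditions ($\mathrm{R}(\lambda,\mathrm{A}(t))$ is the resolvent, $\rho(\mathrm{A}(t))$ the resolvent set): (R1) For each $t\in J$ the linear operator $\mathrm{A}(t)$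 is closed, and its domain $\mathrm{D}(\mathrm{A}(t))=\mathrm{D}(\mathrm{A})$ is dense in $\mathbb{X}$ and independent of $t$. (R2) For $t\in J$, $\mathrm{R}(\lambda,\mathrm{A}(t))$ exists for all $\lambda$ with $\mathrm{Re}\,\lambda\ge0$, and there is $K>0$ with $\|\mathrm{R}(\lambda,\mathrm{A}(t))\|_{\mathcal{L}(\mathbb{X})}\le\frac{K}{|\lambda|+1}$. (R3) There are constants $N>0$ and $0<\delta\le1$ such that $\|(\mathrm{A}(t)-\mathrm{A}(s))\mathrm{A}^{-1}(\tau)\|_{\mathcal{L}(\mathbb{X})}\le N|t-s|^\delta$ for all $t,s,\tau\in J$. (R4) For $t\in J$, $\mathrm{R}(\lambda,\mathrm{A}(t))$ is compact for some $\lambda\in\rho(\mathrm{A}(t))$. An evolution family is a family of bounded linear operators $\{\mathrm{U}(t,s):0\le s\le t\le T\}$ with $\mathrm{U}(s,s)=\mathrm{I}$, $\mathrm{U}(t,r)\mathrm{U}(r,s)=\mathrm{U}(t,s)$ for $0\le s\le r\le t\le T$, and $(t,s)\mapsto\mathrm{U}(t,s)$ strongly continuous. Under (R1)-(R3), $\mathrm{U}(t,s)$ denotes the unique evolution family generated by $\{\mathrm{A}(t)\}$ (Pazy, Chapter 5, Theorem 6.1): $\|\mathrm{U}(t,s)\|_{\mathcal{L}(\mathbb{X})}\le C$ for some $C\ge1$; for $s<t$, $\mathrm{U}(t,s)$ maps $\mathbb{X}$ into $\mathrm{D}(\mathrm{A})$, $\frac{\partial}{\partial t}\mathrm{U}(t,s)=\mathrm{A}(t)\mathrm{U}(t,s)$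 (strongly) with $\|\mathrm{A}(t)\mathrm{U}(t,s)\|_{\mathcal{L}(\mathbb{X})}\le\frac{C}{t-s}$; $\|\mathrm{A}(t)\mathrm{U}(t,s)\mathrm{A}(s)^{-1}\|_{\mathcal{L}(\mathbb{X})}\le C$; and $\frac{\partial}{\partial s}\mathrm{U}(t,s)v=-\mathrm{U}(t,s)\mathrm{A}(s)v$ for $v\in\mathrm{D}(\mathrm{A})$. Under (R1)-(R4), $\mathrm{U}(t,s)$ is a compact operator whenever $t-s>0$ (known result). *)

theory Defs
  imports "HOL-Analysis.Analysis"
begin

section \<open>Complex Banach spaces and operators\<close>

text \<open>
  The resolvent conditions involve complex scalars, so the state space is a complex Banach space:
  a (real) Banach space with a compatible complex scalar multiplication and homogeneous norm.
\<close>

class complex_banach = banach +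
  fixes scaleC :: "complex \<Rightarrow> 'a \<Rightarrow> 'a"  (infixr \<open>*\<^sub>C\<close> 75)
  assumes scaleC_add_right: "a *\<^sub>C (x + y) = a *\<^sub>C x + a *\<^sub>C y"
    and scaleC_add_left: "(a + b) *\<^sub>C x = a *\<^sub>C x + b *\<^sub>C x"
    and scaleC_scaleC: "a *\<^sub>C (b *\<^sub>C x) = (a * b) *\<^sub>C x"
    and scaleC_of_real: "of_real r *\<^sub>C x = r *\<^sub>R x"
    and norm_scaleC: "norm (a *\<^sub>C x) = norm a * norm x"

instantiation complex :: complex_banach
begin
definition scaleC_complex :: "complex \<Rightarrow> complex \<Rightarrow> complex" where
  "scaleC_complex a x = a * x"
instance
  by standard (auto simp: scaleC_complex_def algebra_simps norm_mult scaleR_conv_of_real)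
end

definition bounded_clinear :: "('a::complex_banach \<Rightarrow> 'a) \<Rightarrow> bool" where
  "bounded_clinear f \<longleftrightarrow> bounded_linear f \<and> (\<forall>c x. f (c *\<^sub>C x) = c *\<^sub>C f x)"

definition compact_operator :: "('a::complex_banach \<Rightarrow> 'a) \<Rightarrow> bool" where
  "compact_operator f \<longleftrightarrow>
     bounded_clinear f \<and> (\<forall>S. bounded S \<longrightarrow> compact (closure (f ` S)))"

text \<open>
  An unbounded operator is a domain \<open>D\<close> together with a function \<open>A\<close>; the values of \<open>A\<close>
  outside \<open>D\<close> are irrelevant.
\<close>

definition linear_operator :: "'a::complex_banach set \<Rightarrow> ('a \<Rightarrow> 'a) \<Rightarrow> bool" where
  "linear_operator D A \<longleftrightarrow>
     0 \<in> D \<and>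
     (\<forall>x\<in>D. \<forall>y\<in>D. x + y \<in> D \<and> A (x + y) = A x + A y) \<and>
     (\<forall>c. \<forall>x\<in>D. c *\<^sub>C x \<in> D \<and> A (c *\<^sub>C x) = c *\<^sub>C A x)"

definition closed_operator :: "'a::complex_banach set \<Rightarrow> ('a \<Rightarrow> 'a) \<Rightarrow> bool" where
  "closed_operator D A \<longleftrightarrow> closed {(x, A x) |x. x \<in> D}"

definition inv_operator :: "'a::complex_banach set \<Rightarrow> ('a \<Rightarrow> 'a) \<Rightarrow> 'a \<Rightarrow> 'a" where
  "inv_operator D A = inv_into D A"

definition resolvent :: "'a::complex_banach set \<Rightarrow> ('a \<Rightarrow> 'a) \<Rightarrow> complex \<Rightarrow> 'a \<Rightarrow> 'a" where
  "resolvent D A z = inv_operator D (\<lambda>x. z *\<^sub>C x - A x)"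

definition resolvent_set :: "'a::complex_banach set \<Rightarrow> ('a \<Rightarrow> 'a) \<Rightarrow> complex set" where
  "resolvent_set D A =
     {z. bij_betw (\<lambda>x. z *\<^sub>C x - A x) D UNIV \<and> bounded_clinear (resolvent D A z)}"

section \<open>Conditions on the family of generators\<close>

definition cond_R1 ::
  "real \<Rightarrow> (real \<Rightarrow> 'a::complex_banach set) \<Rightarrow> (real \<Rightarrow> 'a \<Rightarrow> 'a) \<Rightarrow> bool" where
  "cond_R1 T D A \<longleftrightarrow>
     (\<forall>t\<in>{0..T}. linear_operator (D t) (A t) \<and> closed_operator (D t) (A t) \<and>
        closure (D t) = UNIV) \<and>
     (\<forall>t\<in>{0..T}. \<forall>s\<in>{0..T}. D t = D s)"

text \<open>The constant \<open>K\<close> is uniform in \<open>t\<close> and \<open>z\<close>.\<close>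

definition cond_R2 ::
  "real \<Rightarrow> (real \<Rightarrow> 'a::complex_banach set) \<Rightarrow> (real \<Rightarrow> 'a \<Rightarrow> 'a) \<Rightarrow> bool" where
  "cond_R2 T D A \<longleftrightarrow>
     (\<exists>K>0. \<forall>t\<in>{0..T}. \<forall>z. Re z \<ge> 0 \<longrightarrow>
        z \<in> resolvent_set (D t) (A t) \<and>
        onorm (resolvent (D t) (A t) z) \<le> K / (cmod z + 1))"

text \<open>
  \<open>onorm\<close> is the operator norm only for bounded operators, so boundedness is always
  stated alongside a norm estimate.
\<close>

definition cond_R3 ::
  "real \<Rightarrow> (real \<Rightarrow> 'a::complex_banach set) \<Rightarrow> (real \<Rightarrow> 'a \<Rightarrow> 'a) \<Rightarrow> bool" where
  "cond_R3 T D A \<longleftrightarrow>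
     (\<exists>N>0. \<exists>\<delta>>0. \<delta> \<le> 1 \<and>
        (\<forall>t\<in>{0..T}. \<forall>s\<in>{0..T}. \<forall>r\<in>{0..T}.
           let B = (\<lambda>x. A t (inv_operator (D r) (A r) x) - A s (inv_operator (D r) (A r) x))
           in bounded_clinear B \<and> onorm B \<le> N * \<bar>t - s\<bar> powr \<delta>))"

definition cond_R4 ::
  "real \<Rightarrow> (real \<Rightarrow> 'a::complex_banach set) \<Rightarrow> (real \<Rightarrow> 'a \<Rightarrow> 'a) \<Rightarrow> bool" where
  "cond_R4 T D A \<longleftrightarrow>
     (\<forall>t\<in>{0..T}. \<exists>z\<in>resolvent_set (D t) (A t). compact_operator (resolvent (D t) (A t) z))"

section \<open>Evolution families\<close>

definition evolution_family :: "real \<Rightarrow> (real \<Rightarrow> real \<Rightarrow> 'a::complex_banach \<Rightarrow> 'a) \<Rightarrow> bool" where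
  "evolution_family T U \<longleftrightarrow>
     (\<forall>s t. 0 \<le> s \<and> s \<le> t \<and> t \<le> T \<longrightarrow> bounded_clinear (U t s)) \<and>
     (\<forall>s\<in>{0..T}. U s s = id) \<and>
     (\<forall>s r t. 0 \<le> s \<and> s \<le> r \<and> r \<le> t \<and> t \<le> T \<longrightarrow> U t r \<circ> U r s = U t s) \<and>
     (\<forall>x. continuous_on {(t, s). 0 \<le> s \<and> s \<le> t \<and> t \<le> T} (\<lambda>(t, s). U t s x))"

text \<open>
  The evolution family generated by the operators \<open>A t\<close>, in the sense of the existence and
  uniqueness theorem for parabolic evolution equations (Pazy, Chapter 5, Theorem 6.1).
  The derivatives are one-sided at the end points of the parameter ranges.
\<close>

definition generated_evolution_family ::
  "real \<Rightarrow> (real \<Rightarrow> 'a::complex_banach set) \<Rightarrow> (real \<Rightarrow> 'a \<Rightarrow> 'a) \<Rightarrow>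
   (real \<Rightarrow> real \<Rightarrow> 'a \<Rightarrow> 'a) \<Rightarrow> bool" where
  "generated_evolution_family T D A U \<longleftrightarrow>
     evolution_family T U \<and>
     (\<forall>s t. 0 \<le> s \<and> s < t \<and> t \<le> T \<longrightarrow>
        range (U t s) \<subseteq> D t \<and>
        (\<forall>x. ((\<lambda>r. U r s x) has_vector_derivative A t (U t s x)) (at t within {s..T}))) \<and>
     (\<forall>s t. 0 \<le> s \<and> s \<le> t \<and> t \<le> T \<longrightarrow>
        (\<forall>v\<in>D s. ((\<lambda>r. U t r v) has_vector_derivative - U t s (A s v)) (at s within {0..t}))) \<and>
     (\<exists>C\<ge>1.
        (\<forall>s t. 0 \<le> s \<and> s \<le> t \<and> t \<le> T \<longrightarrow> onorm (U t s) \<le> C) \<and>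
        (\<forall>s t. 0 \<le> s \<and> s < t \<and> t \<le> T \<longrightarrow>
           bounded_clinear (A t \<circ> U t s) \<and> onorm (A t \<circ> U t s) \<le> C / (t - s)) \<and>
        (\<forall>s t. 0 \<le> s \<and> s \<le> t \<and> t \<le> T \<longrightarrow>
           bounded_clinear (A t \<circ> U t s \<circ> inv_operator (D s) (A s)) \<and>
           onorm (A t \<circ> U t s \<circ> inv_operator (D s) (A s)) \<le> C))"

section \<open>Bochner integration in arbitrary Banach spaces\<close>

text \<open>
  The library's \<open>has_bochner_integral\<close> requires a second countable codomain. The following is
  the same construction for arbitrary normed spaces, with Borel measurability replaced by strong
  measurability (a.e. limit of simple functions).
\<close>

definition strongly_measurable :: "'b measure \<Rightarrow> ('b \<Rightarrow> 'a::real_normed_vector) \<Rightarrow> bool" where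
  "strongly_measurable M f \<longleftrightarrow>
     (\<exists>s. (\<forall>i::nat. simple_function M (s i)) \<and> (AE x in M. (\<lambda>i. s i x) \<longlonglongrightarrow> f x))"

definition strong_bochner_integrable ::
  "'b measure \<Rightarrow> ('b \<Rightarrow> 'a::real_normed_vector) \<Rightarrow> bool" where
  "strong_bochner_integrable M f \<longleftrightarrow>
     strongly_measurable M f \<and> (\<integral>\<^sup>+x. ennreal (norm (f x)) \<partial>M) < \<infinity>"

definition has_strong_bochner_integral ::
  "'b measure \<Rightarrow> ('b \<Rightarrow> 'a::real_normed_vector) \<Rightarrow> 'a \<Rightarrow> bool" where
  "has_strong_bochner_integral M f I \<longleftrightarrow>
     strongly_measurable M f \<and>
     (\<exists>s. (\<forall>i::nat. Bochner_Integration.simple_bochner_integrable M (s i)) \<and>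
        (\<lambda>i. \<integral>\<^sup>+x. ennreal (norm (f x - s i x)) \<partial>M) \<longlonglongrightarrow> 0 \<and>
        (\<lambda>i. Bochner_Integration.simple_bochner_integral M (s i)) \<longlonglongrightarrow> I)"

definition strong_bochner_integral ::
  "'b measure \<Rightarrow> ('b \<Rightarrow> 'a::real_normed_vector) \<Rightarrow> 'a" where
  "strong_bochner_integral M f = (THE I. has_strong_bochner_integral M f I)"

definition L1_functions :: "real \<Rightarrow> (real \<Rightarrow> 'a::real_normed_vector) set" where
  "L1_functions T = {h. strong_bochner_integrable (lebesgue_on {0..T}) h}"

definition integrably_bounded :: "real \<Rightarrow> (nat \<Rightarrow> real \<Rightarrow> 'a::real_normed_vector) \<Rightarrow> bool" where
  "integrably_bounded T h \<longleftrightarrow>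
     (\<exists>\<sigma> :: real \<Rightarrow> real. integrable (lebesgue_on {0..T}) \<sigma> \<and> (\<forall>t\<in>{0..T}. 0 \<le> \<sigma> t) \<and>
        (AE t in lebesgue_on {0..T}. \<forall>n. norm (h n t) \<le> \<sigma> t))"

section \<open>Piecewise continuous functions\<close>

text \<open>
  Functions on \<open>{0..T}\<close> are represented by functions on \<open>real\<close> that are \<open>undefined\<close>
  elsewhere, so that equality is equality on \<open>{0..T}\<close>.
\<close>

definition PC :: "real \<Rightarrow> (nat \<Rightarrow> real) \<Rightarrow> nat \<Rightarrow> (real \<Rightarrow> 'a::real_normed_vector) set" where
  "PC T \<tau> m =
     {x \<in> extensional {0..T}.
        continuous_on ({0..T} - \<tau> ` {1..m}) x \<and>
        (\<forall>k\<in>{1..m}. (x \<longlongrightarrow> x (\<tau> k)) (at_left (\<tau> k)) \<and>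
                    (\<exists>l. (x \<longlongrightarrow> l) (at_right (\<tau> k))))}"

text \<open>\<open>funspace\<close> carries the supremum metric on bounded functions; see the lemmas below.\<close>

definition PC_metric ::
  "real \<Rightarrow> (nat \<Rightarrow> real) \<Rightarrow> nat \<Rightarrow> (real \<Rightarrow> 'a::real_normed_vector) metric" where
  "PC_metric T \<tau> m = submetric (funspace {0..T} euclidean_metric) (PC T \<tau> m)"

definition relatively_compactin :: "'b topology \<Rightarrow> 'b set \<Rightarrow> bool" where
  "relatively_compactin X S \<longleftrightarrow> S \<subseteq> topspace X \<and> compactin X (X closure_of S)"

text \<open>Piecewise continuous functions are bounded, hence no function is lost in \<open>PC_metric\<close>.\<close>

lemma PC_bounded:
  fixes x :: "real \<Rightarrow> 'a::real_normed_vector"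
  assumes x: "x \<in> PC T \<tau> m"
  shows "bounded (x ` {0..T})"
proof -
  let ?P = "\<tau> ` {1..m}"
  have loc: "\<exists>d>0. bounded (x ` ({0..T} \<inter> ball t d))" if t: "t \<in> {0..T}" for t
  proof -
    have *: "\<exists>B. \<forall>\<^sub>F s in F. norm (x s) \<le> B" if "(x \<longlongrightarrow> l) F" for l and F :: "real filter"
    proof -
      have "\<forall>\<^sub>F s in F. norm (x s) < norm l + 1"
        by (rule order_tendstoD(2)[OF tendsto_norm[OF that]]) simp
      then show ?thesis by (intro exI[of _ "norm l + 1"]) (auto elim: eventually_mono)
    qed
    have "\<exists>B. \<forall>\<^sub>F s in at t within {0..T}. norm (x s) \<le> B"
    proof (cases "t \<in> ?P")
      case True
      then obtain l l' where "(x \<longlongrightarrow> l) (at_left t)" "(x \<longlongrightarrow> l') (at_right t)"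
        using x by (auto simp: PC_def)
      then obtain B B' where B: "\<forall>\<^sub>F s in at_left t. norm (x s) \<le> B"
        "\<forall>\<^sub>F s in at_right t. norm (x s) \<le> B'"
        using * by meson
      have "\<forall>\<^sub>F s in at t. norm (x s) \<le> max B B'"
        using B by (auto simp: eventually_at_split elim!: eventually_mono)
      then have "\<forall>\<^sub>F s in at t within {0..T}. norm (x s) \<le> max B B'"
        by (rule filter_leD[OF at_le, rotated]) auto
      then show ?thesis by blast
    next
      case False
      have "closed ?P" by (intro finite_imp_closed) auto
      then have "at t within {0..T} = at t within ({0..T} - ?P)"
        by (intro at_within_nhd[of t "- ?P"]) (use False in \<open>auto simp: open_Compl\<close>)
      moreover have "(x \<longlongrightarrow> x t) (at t within ({0..T} - ?P))"
        using x t False by (auto simp: PC_def continuous_on_def)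
      ultimately show ?thesis using * by metis
    qed
    then obtain B d where "d > 0"
      and d: "\<And>s. s \<in> {0..T} \<Longrightarrow> s \<noteq> t \<Longrightarrow> dist s t < d \<Longrightarrow> norm (x s) \<le> B"
      by (fastforce simp: eventually_at)
    have "\<forall>s\<in>{0..T} \<inter> ball t d. norm (x s) \<le> max B (norm (x t))"
      using d by (fastforce simp: dist_commute)
    then show ?thesis using \<open>d > 0\<close> by (auto simp: bounded_iff)
  qed
  then obtain d where d: "\<And>t. t \<in> {0..T} \<Longrightarrow> d t > 0 \<and> bounded (x ` ({0..T} \<inter> ball t (d t)))"
    by metis
  have "{0..T} \<subseteq> (\<Union>t\<in>{0..T}. ball t (d t))"
    using d by (meson UN_I centre_in_ball subsetI)
  then obtain F where F: "F \<subseteq> {0..T}" "finite F" "{0..T} \<subseteq> (\<Union>t\<in>F. ball t (d t))"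
    by (rule compactE_image[of "{0..T}" "{0..T}" "\<lambda>t. ball t (d t)", rotated 2]) auto
  have "bounded (\<Union>t\<in>F. x ` ({0..T} \<inter> ball t (d t)))"
    using F d by (intro bounded_UN) auto
  then show ?thesis
    by (rule bounded_subset) (use F in blast)
qed

lemma mspace_PC_metric: "mspace (PC_metric T \<tau> m) = PC T \<tau> m"
  using PC_bounded[of _ T \<tau> m]
  by (auto simp: PC_metric_def Met_TC.fspace_def PC_def)

lemma mdist_PC_metric:
  assumes "0 \<le> T" "x \<in> PC T \<tau> m" "y \<in> PC T \<tau> m"
  shows "mdist (PC_metric T \<tau> m) x y = (SUP s\<in>{0..T}. norm (x s - y s))"
  using assms PC_bounded[of x T \<tau> m] PC_bounded[of y T \<tau> m]
  by (auto simp: PC_metric_def Met_TC.fdist_def Met_TC.fspace_def PC_def dist_norm)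

section \<open>The convolution operator\<close>

definition convolution_operator ::
  "real \<Rightarrow> (real \<Rightarrow> real \<Rightarrow> 'a::complex_banach \<Rightarrow> 'a) \<Rightarrow> (real \<Rightarrow> 'a) \<Rightarrow> real \<Rightarrow> 'a" where
  "convolution_operator T U h =
     (\<lambda>t\<in>{0..T}. strong_bochner_integral (lebesgue_on {0..t}) (\<lambda>s. U t s (h s)))"

end

theory Submission
  imports Defs
begin

text \<open>
  Write \<open>v\<^sub>n = G h\<^sub>n\<close> and let \<open>\<sigma>\<close> dominate all the \<open>h\<^sub>n\<close>. Splitting the integral at \<open>r \<le> t\<close> and
  pulling the bounded operator \<open>U(t,r)\<close> out of the first part gives
  \<open>v\<^sub>n(t) = U(t,r) v\<^sub>n(r) + \<integral>\<^sub>r\<^sup>t U(t,s) h\<^sub>n(s) ds\<close>, so that \<open>v\<^sub>n(t)\<close> differs from \<open>U(t,r) v\<^sub>n(r)\<close> by at most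
  \<open>C \<integral>\<^sub>r\<^sup>t \<sigma>\<close> (lemma \<open>norm_mild_diff_le\<close>). This bound does not depend on \<open>n\<close>, and it is small, uniformly
  in \<open>r\<close> and \<open>t\<close>, when \<open>t - r\<close> is small. A function with this property is called an almost orbit
  below; three consequences of the estimate prove the theorem.

  First, an almost orbit \<open>v\<close> is continuous: near each \<open>t\<close> it is uniformly as close as desired to a
  continuous function \<open>t' \<mapsto> U(t',r) v(r)\<close> with a suitable \<open>r\<close>. Secondly, the values \<open>v\<^sub>n(t)\<close> at a fixed \<open>t > 0\<close> form a totally bounded set:
  up to a small error they lie in the image of a bounded set under \<open>U(t,r)\<close> with \<open>r < t\<close>, and this
  operator is compact. Thirdly, cut \<open>[0,T]\<close> into short pieces with left end points \<open>p\<^sub>i\<close>. Up to a small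
  error the values \<open>v\<^sub>n(p\<^sub>i)\<close> determine \<open>v\<^sub>n\<close> on all of \<open>[0,T]\<close>, and each of these finitely many values
  ranges over a totally bounded set; therefore finitely many of the \<open>v\<^sub>n\<close> form an \<open>\<epsilon>\<close>-net of the sequence
  in the supremum norm (lemma \<open>almost_orbits_totally_bounded\<close>). Since the
  continuous functions on \<open>[0,T]\<close> are complete in the supremum norm and are contained in \<open>PC\<close>, total boundedness yields relative compactness there.

  The compactness of \<open>U(t,s)\<close> for \<open>s < t\<close> comes from the identity
  \<open>U(t,s) = R(\<lambda>,A(t)) (\<lambda> U(t,s) - A(t) U(t,s))\<close>, whose right-hand side is a compact operator applied
  after a bounded one. The integral is the Bochner integral of functions with values in a possibly
  nonseparable space, and its elementary theory is developed first.
\<close>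

section \<open>The Bochner integral of strongly measurable functions\<close>

lemma strongly_measurable_simple: "simple_function M s \<Longrightarrow> strongly_measurable M s"
  unfolding strongly_measurable_def by (intro exI[of _ "\<lambda>_. s"]) auto

lemma strongly_measurable_diff:
  assumes "strongly_measurable M f" "strongly_measurable M g"
  shows "strongly_measurable M (\<lambda>x. f x - g x)"
proof -
  obtain s where s: "\<And>i::nat. simple_function M (s i)" "AE x in M. (\<lambda>i. s i x) \<longlonglongrightarrow> f x"
    using assms(1) unfolding strongly_measurable_def by blast
  obtain t where t: "\<And>i::nat. simple_function M (t i)" "AE x in M. (\<lambda>i. t i x) \<longlonglongrightarrow> g x"
    using assms(2) unfolding strongly_measurable_def by blast
  show ?thesis
    unfolding strongly_measurable_def
  proof (intro exI[of _ "\<lambda>i x. s i x - t i x"] conjI allI)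
    show "simple_function M (\<lambda>x. s i x - t i x)" for i
      using s(1) t(1) by (rule simple_function_compose2)
    show "AE x in M. (\<lambda>i. s i x - t i x) \<longlonglongrightarrow> f x - g x"
      using s(2) t(2) by eventually_elim (rule tendsto_diff)
  qed
qed

text \<open>
  The norm of a strongly measurable function is a limit of measurable functions only almost everywhere,
  and \<open>M\<close> may be incomplete. A measurable version of the norm is what makes the integral of
  norms additive and homogeneous in the next two lemmas.
\<close>

lemma strongly_measurable_norm:
  fixes f :: "'a \<Rightarrow> 'b::real_normed_vector"
  assumes "strongly_measurable M f"
  obtains g :: "'a \<Rightarrow> real" where "g \<in> borel_measurable M" "AE x in M. norm (f x) = g x"
proof -
  obtain s where s: "\<And>i::nat. simple_function M (s i)" "AE x in M. (\<lambda>i. s i x) \<longlonglongrightarrow> f x"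
    using assms unfolding strongly_measurable_def by blast
  have [measurable]: "(\<lambda>x. norm (s i x)) \<in> borel_measurable M" for i
    by (rule borel_measurable_simple_function, rule simple_function_compose1, rule s(1))
  show thesis
  proof (rule that)
    show "(\<lambda>x. lim (\<lambda>i. norm (s i x))) \<in> borel_measurable M"
      by measurable
    show "AE x in M. norm (f x) = lim (\<lambda>i. norm (s i x))"
      using s(2) by eventually_elim (metis limI tendsto_norm)
  qed
qed

lemma nn_integral_norm_triangle:
  assumes "strongly_measurable M f" "strongly_measurable M g"
    and "AE x in M. norm (k x) \<le> norm (f x) + norm (g x)"
  shows "(\<integral>\<^sup>+x. ennreal (norm (k x)) \<partial>M) \<le>
    (\<integral>\<^sup>+x. ennreal (norm (f x)) \<partial>M) + (\<integral>\<^sup>+x. ennreal (norm (g x)) \<partial>M)"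
proof -
  obtain f' where [measurable]: "f' \<in> borel_measurable M" and f': "AE x in M. norm (f x) = f' x"
    using strongly_measurable_norm[OF assms(1)] .
  obtain g' where [measurable]: "g' \<in> borel_measurable M" and g': "AE x in M. norm (g x) = g' x"
    using strongly_measurable_norm[OF assms(2)] .
  have "(\<integral>\<^sup>+x. ennreal (norm (k x)) \<partial>M) \<le> (\<integral>\<^sup>+x. ennreal (f' x) + ennreal (g' x) \<partial>M)"
  proof (rule nn_integral_mono_AE)
    show "AE x in M. ennreal (norm (k x)) \<le> ennreal (f' x) + ennreal (g' x)"
      using assms(3) f' g'
      by eventually_elim (metis ennreal_leI ennreal_plus norm_ge_zero)
  qed
  also have "\<dots> = (\<integral>\<^sup>+x. ennreal (f' x) \<partial>M) + (\<integral>\<^sup>+x. ennreal (g' x) \<partial>M)"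
    by (rule nn_integral_add) auto
  also have "(\<integral>\<^sup>+x. ennreal (f' x) \<partial>M) = (\<integral>\<^sup>+x. ennreal (norm (f x)) \<partial>M)"
    by (rule nn_integral_cong_AE) (use f' in eventually_elim, simp)
  also have "(\<integral>\<^sup>+x. ennreal (g' x) \<partial>M) = (\<integral>\<^sup>+x. ennreal (norm (g x)) \<partial>M)"
    by (rule nn_integral_cong_AE) (use g' in eventually_elim, simp)
  finally show ?thesis .
qed

lemma nn_integral_norm_cmult_le:
  assumes "strongly_measurable M f" and "0 \<le> C" and "AE x in M. norm (k x) \<le> C * norm (f x)"
  shows "(\<integral>\<^sup>+x. ennreal (norm (k x)) \<partial>M) \<le> ennreal C * (\<integral>\<^sup>+x. ennreal (norm (f x)) \<partial>M)"
proof -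
  obtain f' where [measurable]: "f' \<in> borel_measurable M" and f': "AE x in M. norm (f x) = f' x"
    using strongly_measurable_norm[OF assms(1)] .
  have "(\<integral>\<^sup>+x. ennreal (norm (k x)) \<partial>M) \<le> (\<integral>\<^sup>+x. ennreal C * ennreal (f' x) \<partial>M)"
  proof (rule nn_integral_mono_AE)
    show "AE x in M. ennreal (norm (k x)) \<le> ennreal C * ennreal (f' x)"
      using assms(3) f'
      by eventually_elim (metis ennreal_leI ennreal_mult' assms(2))
  qed
  also have "\<dots> = ennreal C * (\<integral>\<^sup>+x. ennreal (f' x) \<partial>M)"
    by (rule nn_integral_cmult) auto
  also have "(\<integral>\<^sup>+x. ennreal (f' x) \<partial>M) = (\<integral>\<^sup>+x. ennreal (norm (f x)) \<partial>M)"
    by (rule nn_integral_cong_AE) (use f' in eventually_elim, simp)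
  finally show ?thesis .
qed

text \<open>
  The integral of the simple function \<open>s - t\<close> is at most the integral of its norm, and the path from
  \<open>s\<close> to \<open>t\<close> may pass through \<open>f\<close> and \<open>g\<close>. With \<open>f = g\<close> this is the Cauchy estimate behind the existence
  of the integral; in the limit it compares the integrals of \<open>f\<close> and \<open>g\<close>.
\<close>

lemma simple_bochner_integral_dist_le:
  fixes f :: "'a \<Rightarrow> 'b::real_normed_vector"
  assumes s: "Bochner_Integration.simple_bochner_integrable M s"
    and t: "Bochner_Integration.simple_bochner_integrable M t"
    and f: "strongly_measurable M f" and g: "strongly_measurable M g"
  shows "ennreal (norm (Bochner_Integration.simple_bochner_integral M s -
      Bochner_Integration.simple_bochner_integral M t)) \<le>
    (\<integral>\<^sup>+x. ennreal (norm (f x - s x)) \<partial>M) +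
    ((\<integral>\<^sup>+x. ennreal (norm (f x - g x)) \<partial>M) + (\<integral>\<^sup>+x. ennreal (norm (g x - t x)) \<partial>M))"
proof -
  have sm: "strongly_measurable M s" "strongly_measurable M t"
    using s t by (auto intro: strongly_measurable_simple elim: simple_bochner_integrable.cases)
  have "ennreal (norm (Bochner_Integration.simple_bochner_integral M s -
      Bochner_Integration.simple_bochner_integral M t)) =
      norm (Bochner_Integration.simple_bochner_integral M (\<lambda>x. s x - t x))"
    using s t by (subst simple_bochner_integral_diff) auto
  also have "\<dots> \<le> Bochner_Integration.simple_bochner_integral M (\<lambda>x. norm (s x - t x))"
    using simple_bochner_integrable_compose2[of "(-)" M s t] s t
    by (auto intro!: simple_bochner_integral_norm_bound)
  also have "\<dots> = (\<integral>\<^sup>+x. norm (s x - t x) \<partial>M)"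
    using simple_bochner_integrable_compose2[of "\<lambda>x y. norm (x - y)" M s t] s t
    by (auto intro!: simple_bochner_integral_eq_nn_integral)
  also have "\<dots> \<le> (\<integral>\<^sup>+x. ennreal (norm (f x - s x)) \<partial>M) +
      (\<integral>\<^sup>+x. ennreal (norm (f x - t x)) \<partial>M)"
    by (intro nn_integral_norm_triangle strongly_measurable_diff f sm AE_I2)
      (subst norm_minus_commute[of "f _"], rule norm_diff_triangle_le[OF order_refl order_refl])
  finally have st: "ennreal (norm (Bochner_Integration.simple_bochner_integral M s -
      Bochner_Integration.simple_bochner_integral M t)) \<le> \<dots>" .
  have "(\<integral>\<^sup>+x. ennreal (norm (f x - t x)) \<partial>M) \<le>
      (\<integral>\<^sup>+x. ennreal (norm (f x - g x)) \<partial>M) + (\<integral>\<^sup>+x. ennreal (norm (g x - t x)) \<partial>M)"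
    by (intro nn_integral_norm_triangle strongly_measurable_diff f g sm AE_I2)
      (rule norm_diff_triangle_le[OF order_refl order_refl])
  then show ?thesis by (rule order_trans[OF st add_left_mono])
qed

text \<open>
  Passing to the limit along both approximating sequences. Taking \<open>g = f\<close> gives uniqueness of the
  integral, and comparing with a second function gives every norm estimate below.
\<close>

lemma has_strong_bochner_integral_dist_le:
  fixes f :: "'a \<Rightarrow> 'b::real_normed_vector"
  assumes f: "has_strong_bochner_integral M f I" and g: "has_strong_bochner_integral M g J"
  shows "ennreal (norm (I - J)) \<le> (\<integral>\<^sup>+x. ennreal (norm (f x - g x)) \<partial>M)"
proof -
  obtain s where s: "\<And>i::nat. Bochner_Integration.simple_bochner_integrable M (s i)"
    "(\<lambda>i. \<integral>\<^sup>+x. ennreal (norm (f x - s i x)) \<partial>M) \<longlonglongrightarrow> 0"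
    "(\<lambda>i. Bochner_Integration.simple_bochner_integral M (s i)) \<longlonglongrightarrow> I"
    using f unfolding has_strong_bochner_integral_def by blast
  obtain t where t: "\<And>i::nat. Bochner_Integration.simple_bochner_integrable M (t i)"
    "(\<lambda>i. \<integral>\<^sup>+x. ennreal (norm (g x - t i x)) \<partial>M) \<longlonglongrightarrow> 0"
    "(\<lambda>i. Bochner_Integration.simple_bochner_integral M (t i)) \<longlonglongrightarrow> J"
    using g unfolding has_strong_bochner_integral_def by blast
  have l: "(\<lambda>i. ennreal (norm (Bochner_Integration.simple_bochner_integral M (s i) -
      Bochner_Integration.simple_bochner_integral M (t i)))) \<longlonglongrightarrow> ennreal (norm (I - J))"
    by (intro tendsto_ennrealI tendsto_norm tendsto_diff s t)
  have r: "(\<lambda>i. (\<integral>\<^sup>+x. ennreal (norm (f x - s i x)) \<partial>M) +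
      ((\<integral>\<^sup>+x. ennreal (norm (f x - g x)) \<partial>M) + (\<integral>\<^sup>+x. ennreal (norm (g x - t i x)) \<partial>M)))
      \<longlonglongrightarrow> 0 + ((\<integral>\<^sup>+x. ennreal (norm (f x - g x)) \<partial>M) + 0)"
    by (intro tendsto_add tendsto_const s t)
  have "strongly_measurable M f" "strongly_measurable M g"
    using f g by (auto simp: has_strong_bochner_integral_def)
  then show ?thesis
    using LIMSEQ_le[OF l r] simple_bochner_integral_dist_le[OF s(1) t(1)] by simp
qed

lemma has_strong_bochner_integral_unique:
  assumes "has_strong_bochner_integral M f I" "has_strong_bochner_integral M f J"
  shows "I = J"
  using has_strong_bochner_integral_dist_le[OF assms] by simp

lemma strong_bochner_integral_eq:
  "has_strong_bochner_integral M f I \<Longrightarrow> strong_bochner_integral M f = I"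
  unfolding strong_bochner_integral_def
  by (blast intro: has_strong_bochner_integral_unique)

lemma has_strong_bochner_integral_zero:
  "has_strong_bochner_integral M (\<lambda>_. 0) (0 :: 'b::real_normed_vector)"
proof -
  have "Bochner_Integration.simple_bochner_integrable M (\<lambda>_. 0 :: 'b)"
    by (simp add: simple_bochner_integrable.simps)
  moreover have "Bochner_Integration.simple_bochner_integral M (\<lambda>_. 0 :: 'b) = 0"
    by (auto simp: simple_bochner_integral_def intro!: sum.neutral)
  ultimately show ?thesis
    unfolding has_strong_bochner_integral_def
    by (intro conjI strongly_measurable_simple simple_function_const exI[of _ "\<lambda>_ _. 0"]) simp_all
qed

lemma has_strong_bochner_integral_bounded_linear:
  assumes L: "bounded_linear L" and f: "has_strong_bochner_integral M f I"
  shows "has_strong_bochner_integral M (\<lambda>x. L (f x)) (L I)"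
proof -
  interpret bounded_linear L by fact
  obtain K where K: "K > 0" "\<And>x. norm (L x) \<le> norm x * K"
    using pos_bounded by blast
  obtain s where s: "\<And>i::nat. Bochner_Integration.simple_bochner_integrable M (s i)"
    "(\<lambda>i. \<integral>\<^sup>+x. ennreal (norm (f x - s i x)) \<partial>M) \<longlonglongrightarrow> 0"
    "(\<lambda>i. Bochner_Integration.simple_bochner_integral M (s i)) \<longlonglongrightarrow> I"
    and fm: "strongly_measurable M f"
    using f unfolding has_strong_bochner_integral_def by blast
  show ?thesis
    unfolding has_strong_bochner_integral_def
  proof (intro conjI exI[of _ "\<lambda>i x. L (s i x)"] allI)
    obtain u where u: "\<And>i::nat. simple_function M (u i)" "AE x in M. (\<lambda>i. u i x) \<longlonglongrightarrow> f x"
      using fm unfolding strongly_measurable_def by blast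
    show "strongly_measurable M (\<lambda>x. L (f x))"
      unfolding strongly_measurable_def
    proof (intro exI[of _ "\<lambda>i x. L (u i x)"] conjI allI)
      show "simple_function M (\<lambda>x. L (u i x))" for i
        using u(1) by (rule simple_function_compose1)
      show "AE x in M. (\<lambda>i. L (u i x)) \<longlonglongrightarrow> L (f x)"
        using u(2) by eventually_elim (rule tendsto)
    qed
    show "Bochner_Integration.simple_bochner_integrable M (\<lambda>x. L (s i x))" for i
      using simple_bochner_integrable_compose2[of "\<lambda>x y. L x", OF _ s(1) s(1)] zero by simp
    show "(\<lambda>i. Bochner_Integration.simple_bochner_integral M (\<lambda>x. L (s i x))) \<longlonglongrightarrow> L I"
      using tendsto[OF s(3)] s(1)
      by (subst simple_bochner_integral_linear) (auto simp: linear_axioms)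
    have "(\<lambda>i. ennreal K * (\<integral>\<^sup>+x. ennreal (norm (f x - s i x)) \<partial>M)) \<longlonglongrightarrow> ennreal K * 0"
      by (intro tendsto_mult_ennreal tendsto_const s(2)) auto
    then have lim: "(\<lambda>i. ennreal K * (\<integral>\<^sup>+x. ennreal (norm (f x - s i x)) \<partial>M)) \<longlonglongrightarrow> 0"
      by simp
    show "(\<lambda>i. \<integral>\<^sup>+x. ennreal (norm (L (f x) - L (s i x))) \<partial>M) \<longlonglongrightarrow> 0"
    proof (rule tendsto_sandwich[OF _ _ tendsto_const lim])
      show "\<forall>\<^sub>F i in sequentially. (\<integral>\<^sup>+x. ennreal (norm (L (f x) - L (s i x))) \<partial>M) \<le>
          ennreal K * (\<integral>\<^sup>+x. ennreal (norm (f x - s i x)) \<partial>M)"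
      proof (intro always_eventually allI nn_integral_norm_cmult_le AE_I2)
        show "strongly_measurable M (\<lambda>x. f x - s i x)" for i
          using s(1)[of i]
          by (intro strongly_measurable_diff[OF fm] strongly_measurable_simple)
            (rule simple_bochner_integrable.cases)
        show "norm (L (f x) - L (s i x)) \<le> K * norm (f x - s i x)" for i x
          using K(2)[of "f x - s i x"] by (simp add: diff mult.commute)
      qed (use K in auto)
    qed auto
  qed
qed

text \<open>
  Turning integrals over a subset into integrals over the whole space is what allows integrals over
  different intervals to be compared with each other.
\<close>

lemma has_strong_bochner_integral_restrict_space:
  fixes f :: "'a \<Rightarrow> 'b::real_normed_vector"
  assumes \<Omega>: "\<Omega> \<inter> space M \<in> sets M" and f: "has_strong_bochner_integral (restrict_space M \<Omega>) f I"
  shows "has_strong_bochner_integral M (\<lambda>x. indicator \<Omega> x *\<^sub>R f x) I"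
proof -
  let ?R = "restrict_space M \<Omega>"
  obtain s where s: "\<And>i::nat. Bochner_Integration.simple_bochner_integrable ?R (s i)"
    "(\<lambda>i. \<integral>\<^sup>+x. ennreal (norm (f x - s i x)) \<partial>?R) \<longlonglongrightarrow> 0"
    "(\<lambda>i. Bochner_Integration.simple_bochner_integral ?R (s i)) \<longlonglongrightarrow> I"
    and fm: "strongly_measurable ?R f"
    using f unfolding has_strong_bochner_integral_def by blast
  show ?thesis
    unfolding has_strong_bochner_integral_def
  proof (intro conjI exI[of _ "\<lambda>i x. indicator \<Omega> x *\<^sub>R s i x"] allI)
    obtain u where u: "\<And>i::nat. simple_function ?R (u i)" "AE x in ?R. (\<lambda>i. u i x) \<longlonglongrightarrow> f x"
      using fm unfolding strongly_measurable_def by blast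
    show "strongly_measurable M (\<lambda>x. indicator \<Omega> x *\<^sub>R f x)"
      unfolding strongly_measurable_def
    proof (intro exI[of _ "\<lambda>i x. indicator \<Omega> x *\<^sub>R u i x"] conjI allI)
      show "simple_function M (\<lambda>x. indicator \<Omega> x *\<^sub>R u i x)" for i
        using u(1) simple_function_restrict_space[OF \<Omega>] by blast
      show "AE x in M. (\<lambda>i. indicator \<Omega> x *\<^sub>R u i x) \<longlonglongrightarrow> indicator \<Omega> x *\<^sub>R f x"
        using u(2) unfolding AE_restrict_space_iff[OF \<Omega>]
        by eventually_elim (auto simp: indicator_def)
    qed
    show "Bochner_Integration.simple_bochner_integrable M (\<lambda>x. indicator \<Omega> x *\<^sub>R s i x)" for i
      using s(1) simple_bochner_integrable_restrict_space[OF \<Omega>] by blast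
    show "(\<lambda>i. Bochner_Integration.simple_bochner_integral M (\<lambda>x. indicator \<Omega> x *\<^sub>R s i x)) \<longlonglongrightarrow> I"
      using s(3) s(1) by (simp add: simple_bochner_integral_restrict_space[OF \<Omega>])
    have "(\<integral>\<^sup>+x. ennreal (norm (f x - s i x)) \<partial>?R) =
        (\<integral>\<^sup>+x. ennreal (norm (indicator \<Omega> x *\<^sub>R f x - indicator \<Omega> x *\<^sub>R s i x)) \<partial>M)" for i
      unfolding nn_integral_restrict_space[OF \<Omega>]
      by (rule nn_integral_cong) (auto simp: indicator_def)
    with s(2) show "(\<lambda>i. \<integral>\<^sup>+x. ennreal (norm (indicator \<Omega> x *\<^sub>R f x - indicator \<Omega> x *\<^sub>R s i x)) \<partial>M)
        \<longlonglongrightarrow> 0" by simp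
  qed
qed

lemma strong_bochner_integrable_has_integral:
  fixes f :: "'a \<Rightarrow> 'b::banach"
  assumes M: "finite_measure M" and f: "strong_bochner_integrable M f"
  shows "has_strong_bochner_integral M f (strong_bochner_integral M f)"
proof -
  interpret finite_measure M by fact
  have fm: "strongly_measurable M f" and fin: "(\<integral>\<^sup>+x. ennreal (norm (f x)) \<partial>M) < \<infinity>"
    using f by (auto simp: strong_bochner_integrable_def)
  obtain s where s: "\<And>i::nat. simple_function M (s i)" "AE x in M. (\<lambda>i. s i x) \<longlonglongrightarrow> f x"
    using fm unfolding strongly_measurable_def by blast
  obtain g where [measurable]: "g \<in> borel_measurable M" and g: "AE x in M. norm (f x) = g x"
    using strongly_measurable_norm[OF fm] .
  \<comment> \<open>Cutting the approximants off at twice the size of \<open>f\<close> makes them dominated without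
    destroying the convergence.\<close>
  define t where "t i x = (if norm (s i x) \<le> 2 * g x then s i x else 0)" for i x
  have t_simple: "simple_function M (t i)" for i
  proof -
    have [measurable]: "(\<lambda>x. norm (s i x)) \<in> borel_measurable M"
      by (rule borel_measurable_simple_function, rule simple_function_compose1, rule s(1))
    show ?thesis
      unfolding t_def by (intro simple_function_If s(1) simple_function_const) measurable
  qed
  have t_int: "Bochner_Integration.simple_bochner_integrable M (t i)" for i
    using t_simple by (auto intro!: simple_bochner_integrable.intros)
  have t_lim: "AE x in M. (\<lambda>i. t i x) \<longlonglongrightarrow> f x"
    using s(2) g
  proof eventually_elim
    case (elim x)
    show ?case
    proof (cases "f x = 0")
      case True
      then have "t i x = 0" for i using elim by (simp add: t_def)
      then show ?thesis using True by simp
    next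
      case False
      have "\<forall>\<^sub>F i in sequentially. norm (s i x) < 2 * norm (f x)"
        by (rule order_tendstoD(2)[OF tendsto_norm[OF elim(1)]]) (use False in simp)
      then have "\<forall>\<^sub>F i in sequentially. s i x = t i x"
        by eventually_elim (use elim in \<open>simp add: t_def\<close>)
      with elim(1) show ?thesis by (rule Lim_transform_eventually)
    qed
  qed
  have diff_m: "strongly_measurable M (\<lambda>x. f x - t i x)" for i
    by (intro strongly_measurable_diff fm strongly_measurable_simple t_simple)
  have "\<exists>v. v \<in> borel_measurable M \<and> (AE x in M. norm (f x - t i x) = v x)" for i
    using strongly_measurable_norm[OF diff_m] by metis
  then obtain v where [measurable]: "\<And>i. v i \<in> borel_measurable M"
    and v: "\<And>i. AE x in M. norm (f x - t i x) = v i x" by metis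
  have v': "AE x in M. \<forall>i. norm (f x - t i x) = v i x"
    using v by (simp add: AE_all_countable)
  have "(\<lambda>i. \<integral>\<^sup>+x. ennreal (v i x) \<partial>M) \<longlonglongrightarrow> (\<integral>\<^sup>+x. 0 \<partial>M)"
  proof (rule nn_integral_dominated_convergence[where w = "\<lambda>x. ennreal (3 * g x)"])
    show "AE x in M. ennreal (v i x) \<le> ennreal (3 * g x)" for i
      using v' g
    proof eventually_elim
      case (elim x)
      have "norm (t i x) \<le> 2 * g x"
        using elim(2) norm_ge_zero[of "f x"] by (auto simp: t_def)
      then have "v i x \<le> 3 * g x"
        using norm_triangle_ineq4[of "f x" "t i x"] elim(2) spec[OF elim(1), of i] by linarith
      then show ?case by (rule ennreal_leI)
    qed
    have "(\<integral>\<^sup>+x. ennreal (3 * g x) \<partial>M) = ennreal 3 * (\<integral>\<^sup>+x. ennreal (g x) \<partial>M)"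
      by (subst nn_integral_cmult[symmetric]) (auto simp: ennreal_mult')
    also have "(\<integral>\<^sup>+x. ennreal (g x) \<partial>M) = (\<integral>\<^sup>+x. ennreal (norm (f x)) \<partial>M)"
      by (rule nn_integral_cong_AE) (use g in eventually_elim, simp)
    finally show "(\<integral>\<^sup>+x. ennreal (3 * g x) \<partial>M) < \<infinity>"
      using fin by (simp add: ennreal_mult_less_top)
    show "AE x in M. (\<lambda>i. ennreal (v i x)) \<longlonglongrightarrow> 0"
      using v' t_lim
    proof eventually_elim
      case (elim x)
      have "(\<lambda>i. ennreal (norm (f x - t i x))) \<longlonglongrightarrow> ennreal (norm (f x - f x))"
        by (intro tendsto_ennrealI tendsto_norm tendsto_diff tendsto_const elim)
      then show ?case using elim by simp
    qed
  qed auto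
  moreover have "(\<integral>\<^sup>+x. ennreal (v i x) \<partial>M) = (\<integral>\<^sup>+x. ennreal (norm (f x - t i x)) \<partial>M)" for i
    by (rule nn_integral_cong_AE) (use v' in eventually_elim, simp)
  ultimately have lim: "(\<lambda>i. \<integral>\<^sup>+x. ennreal (norm (f x - t i x)) \<partial>M) \<longlonglongrightarrow> 0"
    by simp
  have "Cauchy (\<lambda>i. Bochner_Integration.simple_bochner_integral M (t i))"
  proof (rule metric_CauchyI)
    fix e :: real assume "0 < e"
    then have "\<forall>\<^sub>F i in sequentially. (\<integral>\<^sup>+x. ennreal (norm (f x - t i x)) \<partial>M) < ennreal (e / 2)"
      by (intro order_tendstoD(2)[OF lim]) simp
    then obtain N where N: "\<And>i. i \<ge> N \<Longrightarrow> (\<integral>\<^sup>+x. ennreal (norm (f x - t i x)) \<partial>M) < ennreal (e / 2)"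
      by (auto simp: eventually_sequentially)
    have "dist (Bochner_Integration.simple_bochner_integral M (t i))
        (Bochner_Integration.simple_bochner_integral M (t j)) < e" if "i \<ge> N" "j \<ge> N" for i j
    proof -
      have "ennreal (norm (Bochner_Integration.simple_bochner_integral M (t i) -
          Bochner_Integration.simple_bochner_integral M (t j))) \<le>
          (\<integral>\<^sup>+x. ennreal (norm (f x - t i x)) \<partial>M) +
          ((\<integral>\<^sup>+x. ennreal (norm (f x - f x)) \<partial>M) + (\<integral>\<^sup>+x. ennreal (norm (f x - t j x)) \<partial>M))"
        by (intro simple_bochner_integral_dist_le t_int fm)
      also have "\<dots> < ennreal (e / 2) + ennreal (e / 2)"
        using N[OF that(1)] N[OF that(2)] by (simp add: add_strict_mono)
      also have "\<dots> = ennreal e"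
        using \<open>0 < e\<close> by (subst ennreal_plus[symmetric]) auto
      finally show ?thesis
        using \<open>0 < e\<close> by (simp add: dist_norm ennreal_less_iff)
    qed
    then show "\<exists>N. \<forall>i\<ge>N. \<forall>j\<ge>N. dist (Bochner_Integration.simple_bochner_integral M (t i))
        (Bochner_Integration.simple_bochner_integral M (t j)) < e" by blast
  qed
  then obtain I where "(\<lambda>i. Bochner_Integration.simple_bochner_integral M (t i)) \<longlonglongrightarrow> I"
    using Cauchy_convergent convergent_def by blast
  then have "has_strong_bochner_integral M f I"
    unfolding has_strong_bochner_integral_def using fm t_int lim by blast
  then show ?thesis using strong_bochner_integral_eq by blast
qed

section \<open>Convolution with an evolution family\<close>

lemma strongly_measurable_lebesgue_on_subinterval:
  assumes h: "strongly_measurable (lebesgue_on {a..b}) h" and "{c..d} \<subseteq> {a..b::real}"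
  shows "strongly_measurable (lebesgue_on {c..d}) h"
proof -
  have R: "lebesgue_on {c..d} = restrict_space (lebesgue_on {a..b}) {c..d}"
    using assms(2) by (subst restrict_restrict_space) (auto simp: Int_absorb1)
  have \<Omega>: "{c..d} \<inter> space (lebesgue_on {a..b}) \<in> sets (lebesgue_on {a..b})"
    using assms(2) by (auto simp: sets_restrict_space_iff Int_absorb2)
  obtain s where s: "\<And>i::nat. simple_function (lebesgue_on {a..b}) (s i)"
    "AE x in lebesgue_on {a..b}. (\<lambda>i. s i x) \<longlonglongrightarrow> h x"
    using h unfolding strongly_measurable_def by blast
  show ?thesis
    unfolding strongly_measurable_def R
  proof (intro exI[of _ s] conjI allI)
    show "simple_function (restrict_space (lebesgue_on {a..b}) {c..d}) (s i)" for i
      unfolding simple_function_restrict_space[OF \<Omega>]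
    proof (rule simple_function_compose2[of _ _ _ "(*\<^sub>R)"])
      have "{c..d} \<in> sets (lebesgue_on {a..b})"
        using assms(2) by (simp add: sets_restrict_space_iff)
      then show "simple_function (lebesgue_on {a..b}) (indicat_real {c..d})"
        by (rule simple_function_indicator)
    qed (rule s(1))
    show "AE x in restrict_space (lebesgue_on {a..b}) {c..d}. (\<lambda>i. s i x) \<longlonglongrightarrow> h x"
      unfolding AE_restrict_space_iff[OF \<Omega>] using s(2) by eventually_elim simp
  qed
qed

locale bounded_evolution_family =
  fixes T C :: real and U :: "real \<Rightarrow> real \<Rightarrow> 'a::complex_banach \<Rightarrow> 'a"
  assumes T_pos: "0 < T"
    and evolution: "evolution_family T U"
    and C_ge_1: "1 \<le> C"
    and onorm_le: "\<And>s t. 0 \<le> s \<Longrightarrow> s \<le> t \<Longrightarrow> t \<le> T \<Longrightarrow> onorm (U t s) \<le> C"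
begin

lemma bounded_linear_U: "0 \<le> s \<Longrightarrow> s \<le> t \<Longrightarrow> t \<le> T \<Longrightarrow> bounded_linear (U t s)"
  using evolution by (auto simp: evolution_family_def bounded_clinear_def)

lemma norm_U_le:
  assumes "0 \<le> s" "s \<le> t" "t \<le> T"
  shows "norm (U t s x) \<le> C * norm x"
  using onorm[OF bounded_linear_U[OF assms], of x] onorm_le[OF assms]
  by (meson mult_right_mono norm_ge_zero order_trans)

lemma U_compose:
  assumes "0 \<le> s" "s \<le> r" "r \<le> t" "t \<le> T"
  shows "U t r (U r s x) = U t s x"
proof -
  have "U t r \<circ> U r s = U t s"
    using evolution assms by (simp add: evolution_family_def)
  from fun_cong[OF this, of x] show ?thesis by simp
qed

lemma continuous_on_U: "continuous_on {(t, s). 0 \<le> s \<and> s \<le> t \<and> t \<le> T} (\<lambda>(t, s). U t s x)"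
  using evolution by (simp add: evolution_family_def)

lemma continuous_on_U_start:
  assumes "0 \<le> t" "t \<le> T"
  shows "continuous_on {0..t} (\<lambda>s. U t s x)"
  using assms by (intro continuous_on_compose2[OF continuous_on_U, where f = "\<lambda>s. (t, s)", simplified])
    (auto intro!: continuous_intros)

lemma continuous_on_U_end:
  assumes "0 \<le> s" "s \<le> T"
  shows "continuous_on {s..T} (\<lambda>t. U t s x)"
  using assms by (intro continuous_on_compose2[OF continuous_on_U, where f = "\<lambda>t. (t, s)", simplified])
    (auto intro!: continuous_intros)

text \<open>
  If the simple functions \<open>u\<^sub>i\<close> converge to \<open>h\<close>, then \<open>U(t,s) u\<^sub>i(s)\<close> is not simple, because \<open>U(t,s)\<close> varies
  with \<open>s\<close>. Rounding \<open>s\<close> down to a multiple \<open>q\<^sub>i(s)\<close> of \<open>1/(i+1)\<close> makes it simple, and the limit is still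
  \<open>U(t,s) h(s)\<close> by strong continuity and the uniform bound on the operators. Rounding down, not up,
  keeps \<open>q\<^sub>i(s)\<close> in \<open>[0,t]\<close>, where \<open>U(t,q\<^sub>i(s))\<close> belongs to the evolution family.
\<close>

lemma strongly_measurable_U_apply:
  assumes t: "0 \<le> t" "t \<le> T" and h: "strongly_measurable (lebesgue_on {0..T}) h"
  shows "strongly_measurable (lebesgue_on {0..t}) (\<lambda>s. U t s (h s))"
proof -
  have "strongly_measurable (lebesgue_on {0..t}) h"
    using strongly_measurable_lebesgue_on_subinterval[OF h] t by simp
  then obtain u where u: "\<And>i::nat. simple_function (lebesgue_on {0..t}) (u i)"
    "AE s in lebesgue_on {0..t}. (\<lambda>i. u i s) \<longlonglongrightarrow> h s"
    unfolding strongly_measurable_def by blast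
  define q where "q i s = real_of_int \<lfloor>real (Suc i) * s\<rfloor> / real (Suc i)" for i s
  have q_range: "q i s \<in> {0..s}" if "0 \<le> s" for i s
    using that by (auto simp: q_def divide_simps mult.commute)
  have q_lim: "(\<lambda>i. q i s) \<longlonglongrightarrow> s" for s
  proof -
    have l: "(\<lambda>i. s - inverse (real (Suc i))) \<longlonglongrightarrow> s - 0"
      by (intro tendsto_intros LIMSEQ_inverse_real_of_nat)
    have lo: "s - inverse (real (Suc i)) \<le> q i s" for i
    proof -
      have "s - inverse (real (Suc i)) = (real (Suc i) * s - 1) / real (Suc i)"
        by (simp add: divide_simps)
      also have "\<dots> \<le> q i s"
        unfolding q_def by (rule divide_right_mono) linarith+
      finally show ?thesis .
    qed
    have up: "q i s \<le> s" for i
      unfolding q_def by (simp add: divide_simps mult.commute)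
    show ?thesis
      by (rule tendsto_sandwich[OF _ _ l[simplified] tendsto_const]) (use lo up in auto)
  qed
  have q_simple: "simple_function (lebesgue_on {0..t}) (q i)" for i
  proof -
    have "q i ` {0..t} \<subseteq> (\<lambda>k. real_of_int k / real (Suc i)) ` {0..\<lfloor>real (Suc i) * t\<rfloor>}"
    proof
      fix y assume "y \<in> q i ` {0..t}"
      then obtain s where s: "s \<in> {0..t}" "y = q i s" by blast
      then have "\<lfloor>real (Suc i) * s\<rfloor> \<in> {0..\<lfloor>real (Suc i) * t\<rfloor>}"
        by (simp add: floor_mono mult_left_mono)
      then show "y \<in> (\<lambda>k. real_of_int k / real (Suc i)) ` {0..\<lfloor>real (Suc i) * t\<rfloor>}"
        unfolding s(2) q_def by (rule imageI)
    qed
    from finite_subset[OF this] have "finite (q i ` space (lebesgue_on {0..t}))"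
      by simp
    moreover have "q i \<in> borel_measurable (lebesgue_on {0..t})"
      unfolding q_def by (intro measurable_restrict_space1 measurable_completion) measurable
    ultimately show ?thesis
      by (simp add: simple_function_iff_borel_measurable)
  qed
  show ?thesis
    unfolding strongly_measurable_def
  proof (intro exI[of _ "\<lambda>i s. U t (q i s) (u i s)"] conjI allI)
    show "simple_function (lebesgue_on {0..t}) (\<lambda>s. U t (q i s) (u i s))" for i
      by (rule simple_function_compose2[OF q_simple u(1)])
    have "AE s in lebesgue_on {0..t}. s \<in> {0..t}"
      by (rule AE_I2) simp
    with u(2) show "AE s in lebesgue_on {0..t}. (\<lambda>i. U t (q i s) (u i s)) \<longlonglongrightarrow> U t s (h s)"
    proof eventually_elim
      case (elim s)
      have q: "0 \<le> q i s" "q i s \<le> t" for i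
        using q_range[of s i] elim by auto
      have "(\<lambda>i. U t (q i s) (h s)) \<longlonglongrightarrow> U t s (h s)"
        by (rule continuous_on_tendsto_compose[OF continuous_on_U_start[OF t] q_lim])
          (use elim q in auto)
      moreover have "(\<lambda>i. U t (q i s) (u i s - h s)) \<longlonglongrightarrow> 0"
      proof (rule Lim_null_comparison)
        show "\<forall>\<^sub>F i in sequentially. norm (U t (q i s) (u i s - h s)) \<le> C * norm (u i s - h s)"
          by (intro always_eventually allI norm_U_le q t)
        have "(\<lambda>i. C * norm (u i s - h s)) \<longlonglongrightarrow> C * norm (h s - h s)"
          by (intro tendsto_intros elim)
        then show "(\<lambda>i. C * norm (u i s - h s)) \<longlonglongrightarrow> 0" by simp
      qed
      ultimately have "(\<lambda>i. U t (q i s) (h s) + U t (q i s) (u i s - h s)) \<longlonglongrightarrow> U t s (h s) + 0"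
        by (rule tendsto_add)
      moreover have "U t (q i s) (h s) + U t (q i s) (u i s - h s) = U t (q i s) (u i s)" for i
        using linear_add[OF bounded_linear.linear[OF bounded_linear_U[OF q t(2)]], of i "h s" "u i s - h s"]
        by simp
      ultimately show ?case by simp
    qed
  qed
qed

lemma nn_integral_dominated_le:
  assumes r: "0 \<le> r" "r \<le> t" "t \<le> T"
    and \<sigma>: "integrable (lebesgue_on {0..T}) \<sigma>" "\<And>s. s \<in> {0..T} \<Longrightarrow> 0 \<le> \<sigma> s"
    and k: "AE s in lebesgue_on {0..t}. norm (k s) \<le> C * (indicator {r..t} s * \<sigma> s)"
  shows "(\<integral>\<^sup>+s. ennreal (norm (k s)) \<partial>lebesgue_on {0..t}) \<le> ennreal (C * integral {r..t} \<sigma>)"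
proof -
  have \<Omega>: "{r..t} \<inter> space (lebesgue_on {0..t}) \<in> sets (lebesgue_on {0..t})"
    using r by (auto simp: sets_restrict_space_iff Int_absorb2)
  have R: "lebesgue_on {r..t} = restrict_space (lebesgue_on {0..t}) {r..t}"
    using r by (subst restrict_restrict_space) (auto simp: Int_absorb1)
  have int: "integrable (lebesgue_on {r..t}) \<sigma>"
    using integrable_subinterval[OF \<sigma>(1)] r by simp
  have "(\<integral>\<^sup>+s. ennreal (norm (k s)) \<partial>lebesgue_on {0..t}) \<le>
      (\<integral>\<^sup>+s. ennreal (C * \<sigma> s) * indicator {r..t} s \<partial>lebesgue_on {0..t})"
    using k by (intro nn_integral_mono_AE, eventually_elim) (auto simp: indicator_def intro: ennreal_leI)
  also have "\<dots> = (\<integral>\<^sup>+s. ennreal (C * \<sigma> s) \<partial>lebesgue_on {r..t})"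
    unfolding R nn_integral_restrict_space[OF \<Omega>] ..
  also have "\<dots> = ennreal (\<integral>s. C * \<sigma> s \<partial>lebesgue_on {r..t})"
    using int C_ge_1 \<sigma>(2) r
    by (intro nn_integral_eq_integral AE_I2) auto
  also have "(\<integral>s. C * \<sigma> s \<partial>lebesgue_on {r..t}) = C * integral {r..t} \<sigma>"
    using lebesgue_integral_eq_integral[OF int] by simp
  finally show ?thesis .
qed

end

locale dominated_forcing = bounded_evolution_family T C U
  for T C and U :: "real \<Rightarrow> real \<Rightarrow> 'a::complex_banach \<Rightarrow> 'a" +
  fixes h :: "real \<Rightarrow> 'a" and \<sigma> :: "real \<Rightarrow> real"
  assumes h_measurable: "strongly_measurable (lebesgue_on {0..T}) h"
    and \<sigma>_integrable: "integrable (lebesgue_on {0..T}) \<sigma>"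
    and \<sigma>_nonneg: "\<And>s. s \<in> {0..T} \<Longrightarrow> 0 \<le> \<sigma> s"
    and norm_h_le: "AE s in lebesgue_on {0..T}. norm (h s) \<le> \<sigma> s"
begin

abbreviation mild where "mild \<equiv> convolution_operator T U h"

lemma \<sigma>_integrable_on: "0 \<le> a \<Longrightarrow> b \<le> T \<Longrightarrow> \<sigma> integrable_on {a..b}"
  using integrable_subinterval[OF \<sigma>_integrable] by (intro integrable_on_lebesgue_on) auto

lemma AE_norm_U_h_le:
  assumes "0 \<le> t" "t \<le> T"
  shows "AE s in lebesgue_on {0..t}. norm (U t s (h s)) \<le> C * \<sigma> s"
proof -
  have "AE s in lebesgue. s \<in> {0..T} \<longrightarrow> norm (h s) \<le> \<sigma> s"
    using norm_h_le by (subst (asm) AE_restrict_space_iff) auto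
  then have "AE s in lebesgue. s \<in> {0..t} \<longrightarrow> norm (U t s (h s)) \<le> C * \<sigma> s"
  proof eventually_elim
    case (elim s)
    show ?case
    proof
      assume s: "s \<in> {0..t}"
      then have "norm (U t s (h s)) \<le> C * norm (h s)"
        using assms by (intro norm_U_le) auto
      also have "\<dots> \<le> C * \<sigma> s"
        using s elim assms C_ge_1 by (intro mult_left_mono) auto
      finally show "norm (U t s (h s)) \<le> C * \<sigma> s" .
    qed
  qed
  then show ?thesis by (subst AE_restrict_space_iff) auto
qed

lemma mild_has_integral:
  assumes t: "0 \<le> t" "t \<le> T"
  shows "has_strong_bochner_integral (lebesgue_on {0..t}) (\<lambda>s. U t s (h s)) (mild t)"
proof -
  have "AE s in lebesgue_on {0..t}. s \<in> {0..t}"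
    by (rule AE_I2) simp
  with AE_norm_U_h_le[OF t]
  have "AE s in lebesgue_on {0..t}. norm (U t s (h s)) \<le> C * (indicator {0..t} s * \<sigma> s)"
    by eventually_elim simp
  from nn_integral_dominated_le[OF _ _ _ \<sigma>_integrable \<sigma>_nonneg this] t
  have "(\<integral>\<^sup>+s. ennreal (norm (U t s (h s))) \<partial>lebesgue_on {0..t}) < \<infinity>"
    using order_le_less_trans[OF _ ennreal_less_top] by simp
  then have "strong_bochner_integrable (lebesgue_on {0..t}) (\<lambda>s. U t s (h s))"
    using strongly_measurable_U_apply[OF t h_measurable]
    by (simp add: strong_bochner_integrable_def)
  then show ?thesis
    using t strong_bochner_integrable_has_integral[OF finite_measure_lebesgue_on, of "{0..t}"]
    by (simp add: convolution_operator_def)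
qed

text \<open>
  By the evolution property \<open>U(t,r)\<close> carries the integral up to time \<open>r\<close> to the integral of
  \<open>s \<mapsto> U(t,s) h(s)\<close> over \<open>[0,r]\<close>. Read as an integral over \<open>[0,t]\<close>, it differs from the full convolution
  only by the part of the integrand on \<open>[r,t]\<close>.
\<close>

lemma norm_mild_diff_le:
  assumes r: "0 \<le> r" "r \<le> t" "t \<le> T"
  shows "norm (mild t - U t r (mild r)) \<le> C * integral {r..t} \<sigma>"
proof -
  have \<Omega>: "{0..r} \<inter> space (lebesgue_on {0..t}) \<in> sets (lebesgue_on {0..t})"
    using r by (auto simp: sets_restrict_space_iff Int_absorb2)
  have R: "lebesgue_on {0..r} = restrict_space (lebesgue_on {0..t}) {0..r}"
    using r by (subst restrict_restrict_space) (auto simp: Int_absorb1)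
  have "has_strong_bochner_integral (lebesgue_on {0..r}) (\<lambda>s. U t r (U r s (h s))) (U t r (mild r))"
    using has_strong_bochner_integral_bounded_linear[OF bounded_linear_U mild_has_integral] r by simp
  then have J: "has_strong_bochner_integral (lebesgue_on {0..t})
      (\<lambda>s. indicator {0..r} s *\<^sub>R U t r (U r s (h s))) (U t r (mild r))"
    unfolding R by (rule has_strong_bochner_integral_restrict_space[OF \<Omega>])
  have I: "has_strong_bochner_integral (lebesgue_on {0..t}) (\<lambda>s. U t s (h s)) (mild t)"
    using r by (intro mild_has_integral) auto
  have "AE s in lebesgue_on {0..t}. s \<in> {0..t}"
    by (rule AE_I2) simp
  moreover have "AE s in lebesgue_on {0..t}. norm (U t s (h s)) \<le> C * \<sigma> s"
    using r by (intro AE_norm_U_h_le) auto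
  ultimately have "AE s in lebesgue_on {0..t}.
      norm (U t s (h s) - indicator {0..r} s *\<^sub>R U t r (U r s (h s)))
        \<le> C * (indicator {r..t} s * \<sigma> s)"
  proof eventually_elim
    case (elim s)
    show ?case
    proof (cases "s \<le> r")
      case True
      then have "U t r (U r s (h s)) = U t s (h s)"
        using elim r by (intro U_compose) auto
      moreover have "0 \<le> C * (indicator {r..t} s * \<sigma> s)"
        using C_ge_1 \<sigma>_nonneg[of s] elim r by auto
      ultimately show ?thesis using True elim by simp
    qed (use elim in auto)
  qed
  with r have "(\<integral>\<^sup>+s. ennreal (norm (U t s (h s) - indicator {0..r} s *\<^sub>R U t r (U r s (h s))))
      \<partial>lebesgue_on {0..t}) \<le> ennreal (C * integral {r..t} \<sigma>)"
    by (intro nn_integral_dominated_le \<sigma>_integrable \<sigma>_nonneg) auto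
  with has_strong_bochner_integral_dist_le[OF I J]
  have "ennreal (norm (mild t - U t r (mild r))) \<le> ennreal (C * integral {r..t} \<sigma>)"
    by (rule order_trans)
  moreover have "0 \<le> C * integral {r..t} \<sigma>"
    using C_ge_1 \<sigma>_nonneg r \<sigma>_integrable_on[of r t]
    by (intro mult_nonneg_nonneg integral_nonneg) auto
  ultimately show ?thesis by (simp add: ennreal_le_iff)
qed

lemma mild_0: "mild 0 = 0"
proof -
  have I: "has_strong_bochner_integral (lebesgue_on {0..0}) (\<lambda>s. U 0 s (h s)) (mild 0)"
    using T_pos by (intro mild_has_integral) auto
  have "(\<integral>\<^sup>+s. ennreal (norm (U 0 s (h s) - 0)) \<partial>lebesgue_on {0..0::real}) =
      (\<integral>\<^sup>+s. 0 \<partial>lebesgue_on {0..0::real})"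
  proof (rule nn_integral_cong_AE)
    have "{0..0::real} \<in> null_sets lebesgue" by simp
    then have "AE s in lebesgue. s \<notin> {0..0::real}" by (rule AE_not_in)
    then have "AE s in lebesgue. s \<in> {0..0} \<longrightarrow> ennreal (norm (U 0 s (h s) - 0)) = 0"
      by eventually_elim simp
    then show "AE s in lebesgue_on {0..0::real}. ennreal (norm (U 0 s (h s) - 0)) = 0"
      by (subst AE_restrict_space_iff) (simp, assumption)
  qed
  with has_strong_bochner_integral_dist_le[OF I has_strong_bochner_integral_zero]
  show ?thesis by simp
qed

lemma norm_mild_le:
  assumes "0 \<le> t" "t \<le> T"
  shows "norm (mild t) \<le> C * integral {0..t} \<sigma>"
  using norm_mild_diff_le[of 0 t] assms mild_0 linear_0[OF bounded_linear.linear[OF bounded_linear_U]]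
  by simp

end

section \<open>Almost orbits\<close>

lemma integral_small_on_short_intervals:
  fixes \<sigma> :: "real \<Rightarrow> real"
  assumes \<sigma>: "\<sigma> integrable_on {a..b}" and "0 < e"
  shows "\<exists>\<delta>>0. \<forall>r t. a \<le> r \<longrightarrow> r \<le> t \<longrightarrow> t \<le> b \<longrightarrow> t - r < \<delta> \<longrightarrow> integral {r..t} \<sigma> < e"
proof -
  have "uniformly_continuous_on {a..b} (\<lambda>x. integral {a..x} \<sigma>)"
    by (intro compact_uniformly_continuous indefinite_integral_continuous_1 \<sigma> compact_Icc)
  then obtain \<delta> where "0 < \<delta>" and \<delta>: "\<And>r t. r \<in> {a..b} \<Longrightarrow> t \<in> {a..b} \<Longrightarrow> dist t r < \<delta> \<Longrightarrow>
      dist (integral {a..t} \<sigma>) (integral {a..r} \<sigma>) < e"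
    unfolding uniformly_continuous_on_def using \<open>0 < e\<close> by metis
  show ?thesis
  proof (intro exI[of _ \<delta>] conjI allI impI \<open>0 < \<delta>\<close>)
    fix r t assume rt: "a \<le> r" "r \<le> t" "t \<le> b" "t - r < \<delta>"
    have "integral {a..r} \<sigma> + integral {r..t} \<sigma> = integral {a..t} \<sigma>"
      using rt by (intro Henstock_Kurzweil_Integration.integral_combine integrable_subinterval_real[OF \<sigma>]) auto
    then show "integral {r..t} \<sigma> < e"
      using \<delta>[of r t] rt by (auto simp: dist_real_def)
  qed
qed

context bounded_evolution_family
begin

text \<open>
  This isolates what the compactness argument needs from the integral representation: between two
  times the function follows the evolution family up to an error controlled by the mass of \<open>\<sigma>\<close>.
\<close>

definition almost_orbit :: "(real \<Rightarrow> real) \<Rightarrow> (real \<Rightarrow> 'a) \<Rightarrow> bool" where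
  "almost_orbit \<sigma> v \<longleftrightarrow>
     (\<forall>r t. 0 \<le> r \<and> r \<le> t \<and> t \<le> T \<longrightarrow> dist (v t) (U t r (v r)) \<le> C * integral {r..t} \<sigma>)"

text \<open>
  The bound \<open>\<delta>\<close> is chosen before \<open>v\<close>: it serves all almost orbits with the same \<open>\<sigma>\<close> at once.
\<close>

lemma almost_orbit_uniform:
  assumes \<sigma>: "\<sigma> integrable_on {0..T}" and "0 < e"
  shows "\<exists>\<delta>>0. \<forall>v r t. almost_orbit \<sigma> v \<longrightarrow> 0 \<le> r \<longrightarrow> r \<le> t \<longrightarrow> t \<le> T \<longrightarrow> t - r < \<delta> \<longrightarrow>
    dist (v t) (U t r (v r)) < e"
proof -
  have "0 < e / C" using \<open>0 < e\<close> C_ge_1 by simp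
  from integral_small_on_short_intervals[OF \<sigma> this] obtain \<delta> where "0 < \<delta>" and
    \<delta>: "\<And>r t. 0 \<le> r \<Longrightarrow> r \<le> t \<Longrightarrow> t \<le> T \<Longrightarrow> t - r < \<delta> \<Longrightarrow> integral {r..t} \<sigma> < e / C"
    by blast
  show ?thesis
  proof (intro exI[of _ \<delta>] conjI allI impI \<open>0 < \<delta>\<close>)
    fix v r t assume v: "almost_orbit \<sigma> v" and rt: "0 \<le> r" "r \<le> t" "t \<le> T" "t - r < \<delta>"
    have "dist (v t) (U t r (v r)) \<le> C * integral {r..t} \<sigma>"
      using v rt by (simp add: almost_orbit_def)
    also have "\<dots> < e"
      using \<delta>[OF rt] C_ge_1 by (simp add: pos_less_divide_eq mult.commute)
    finally show "dist (v t) (U t r (v r)) < e" .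
  qed
qed

text \<open>
  Continuity at \<open>t\<close> is inherited from the true orbit starting at a time \<open>r\<close> slightly before \<open>t\<close>. Starting
  strictly before \<open>t\<close> (if \<open>t > 0\<close>) is what covers the points to the left of \<open>t\<close> as well.
\<close>

lemma continuous_on_almost_orbit:
  assumes \<sigma>: "\<sigma> integrable_on {0..T}" and v: "almost_orbit \<sigma> v"
  shows "continuous_on {0..T} v"
  unfolding continuous_on_iff
proof (intro ballI allI impI)
  fix t e :: real assume t: "t \<in> {0..T}" and "0 < e"
  then have "0 < e / 3" by simp
  from almost_orbit_uniform[OF \<sigma> this] obtain \<delta> where "0 < \<delta>" and
    \<delta>: "\<And>r t. 0 \<le> r \<Longrightarrow> r \<le> t \<Longrightarrow> t \<le> T \<Longrightarrow> t - r < \<delta> \<Longrightarrow> dist (v t) (U t r (v r)) < e / 3"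
    using v by blast
  \<comment> \<open>Going back by \<open>\<delta>/2\<close> only leaves room for times up to \<open>\<delta>/2\<close> after \<open>t\<close>.\<close>
  define r where "r = max 0 (t - \<delta> / 2)"
  have r: "0 \<le> r" "r \<le> t" "t - r < \<delta>" "r \<le> T"
    using t \<open>0 < \<delta>\<close> by (auto simp: r_def)
  obtain d where "0 < d" and d: "\<And>t'. t' \<in> {r..T} \<Longrightarrow> dist t' t < d \<Longrightarrow>
      dist (U t' r (v r)) (U t r (v r)) < e / 3"
    using continuous_on_U_end[OF r(1,4), of "v r", unfolded continuous_on_iff,
        rule_format, of t "e / 3"] t r(2) \<open>0 < e / 3\<close>
    by auto
  show "\<exists>d>0. \<forall>t'\<in>{0..T}. dist t' t < d \<longrightarrow> dist (v t') (v t) < e"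
  proof (intro exI[of _ "min d (\<delta> / 2)"] conjI ballI impI)
    show "0 < min d (\<delta> / 2)" using \<open>0 < d\<close> \<open>0 < \<delta>\<close> by simp
    fix t' assume t': "t' \<in> {0..T}" "dist t' t < min d (\<delta> / 2)"
    then have rt': "r \<le> t'" "t' - r < \<delta>"
      by (auto simp: r_def dist_real_def abs_if max_def split: if_splits)
    have "dist (v t') (U t' r (v r)) < e / 3"
      using \<delta>[of r t'] r rt' t' by simp
    moreover have "dist (U t' r (v r)) (U t r (v r)) < e / 3"
      using d[of t'] rt' t' by simp
    moreover have "dist (v t) (U t r (v r)) < e / 3"
      using \<delta>[of r t] r t by simp
    ultimately show "dist (v t') (v t) < e"
      using dist_triangle[of "v t'" "v t" "U t' r (v r)"]
        dist_triangle2[of "U t' r (v r)" "v t" "U t r (v r)"] by linarith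
  qed
qed

end

locale compact_evolution_family = bounded_evolution_family +
  assumes compact_U:
    "\<And>s t S. 0 \<le> s \<Longrightarrow> s < t \<Longrightarrow> t \<le> T \<Longrightarrow> bounded S \<Longrightarrow> compact (closure (U t s ` S))"
begin

text \<open>
  Up to a small error \<open>v(t)\<close> lies in the image under the compact operator \<open>U(t,r)\<close>, \<open>r < t\<close>, of the bounded
  set of the values \<open>v(r)\<close>. At \<open>t = 0\<close> there is no earlier time, whence the common initial value.
\<close>

lemma almost_orbits_totally_bounded_at:
  assumes \<sigma>: "\<sigma> integrable_on {0..T}" and V: "\<And>v. v \<in> V \<Longrightarrow> almost_orbit \<sigma> v"
    and V0: "\<And>v. v \<in> V \<Longrightarrow> v 0 = x0"
    and bdd: "\<And>r. r \<in> {0..T} \<Longrightarrow> bounded ((\<lambda>v. v r) ` V)"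
    and t: "t \<in> {0..T}" and "0 < e"
  shows "\<exists>K. finite K \<and> (\<forall>v\<in>V. \<exists>y\<in>K. dist (v t) y < e)"
proof (cases "t = 0")
  case True
  then show ?thesis using V0 \<open>0 < e\<close> by (intro exI[of _ "{x0}"]) auto
next
  case False
  have "0 < e / 2" using \<open>0 < e\<close> by simp
  from almost_orbit_uniform[OF \<sigma> this] obtain \<delta> where "0 < \<delta>" and
    \<delta>: "\<And>v r t. v \<in> V \<Longrightarrow> 0 \<le> r \<Longrightarrow> r \<le> t \<Longrightarrow> t \<le> T \<Longrightarrow> t - r < \<delta> \<Longrightarrow>
      dist (v t) (U t r (v r)) < e / 2"
    using V by blast
  define r where "r = max 0 (t - \<delta> / 2)"
  have r: "0 \<le> r" "r < t" "t - r < \<delta>" "t \<le> T"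
    using t False \<open>0 < \<delta>\<close> by (auto simp: r_def)
  have "bounded ((\<lambda>v. v r) ` V)"
    using r by (intro bdd) simp
  with r(1,2,4) have "compact (closure (U t r ` (\<lambda>v. v r) ` V))"
    by (rule compact_U)
  then have "\<exists>K. finite K \<and> closure (U t r ` (\<lambda>v. v r) ` V) \<subseteq> (\<Union>y\<in>K. ball y (e / 2))"
    using \<open>0 < e / 2\<close> by (simp add: compact_eq_totally_bounded)
  then obtain K where K: "finite K" "closure (U t r ` (\<lambda>v. v r) ` V) \<subseteq> (\<Union>y\<in>K. ball y (e / 2))"
    by blast
  have "\<exists>y\<in>K. dist (v t) y < e" if "v \<in> V" for v
  proof -
    have "U t r (v r) \<in> U t r ` (\<lambda>v. v r) ` V"
      using that by blast
    also have "\<dots> \<subseteq> closure (U t r ` (\<lambda>v. v r) ` V)"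
      by (rule closure_subset)
    finally obtain y where y: "y \<in> K" "dist y (U t r (v r)) < e / 2"
      using K(2) by auto
    have "dist (v t) (U t r (v r)) < e / 2"
      using \<delta>[OF that] r by simp
    then have "dist (v t) y < e"
      using y(2) dist_triangle2[of "v t" y "U t r (v r)"] by linarith
    with y(1) show ?thesis by blast
  qed
  with K(1) show ?thesis by blast
qed

text \<open>
  A pigeonhole argument. Each \<open>v\<close> is coded by the points of finite \<open>\<eta>\<close>-nets that approximate its values
  at the grid points \<open>p\<^sub>i = i \<delta>\<close>; there are finitely many codes. Two almost orbits with the same code are
  \<open>2 \<eta>\<close>-close at each \<open>p\<^sub>i\<close>, hence \<open>2 C \<eta>\<close>-close along the true orbits starting there, up to two errors of
  size \<open>e/4\<close>. The choice \<open>\<eta> = e/(4 C)\<close> adds up to \<open>e\<close>.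
\<close>

lemma almost_orbits_totally_bounded:
  assumes \<sigma>: "\<sigma> integrable_on {0..T}" and V: "\<And>v. v \<in> V \<Longrightarrow> almost_orbit \<sigma> v"
    and V0: "\<And>v. v \<in> V \<Longrightarrow> v 0 = x0"
    and bdd: "\<And>r. r \<in> {0..T} \<Longrightarrow> bounded ((\<lambda>v. v r) ` V)"
    and "0 < e"
  shows "\<exists>W. finite W \<and> W \<subseteq> V \<and> (\<forall>v\<in>V. \<exists>w\<in>W. \<forall>t\<in>{0..T}. dist (v t) (w t) \<le> e)"
proof -
  define \<eta> where "\<eta> = e / (4 * C)"
  have "0 < \<eta>" using \<open>0 < e\<close> C_ge_1 by (simp add: \<eta>_def)
  have "0 < e / 4" using \<open>0 < e\<close> by simp
  from almost_orbit_uniform[OF \<sigma> this] obtain \<delta> where "0 < \<delta>" and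
    \<delta>: "\<And>v r t. v \<in> V \<Longrightarrow> 0 \<le> r \<Longrightarrow> r \<le> t \<Longrightarrow> t \<le> T \<Longrightarrow> t - r < \<delta> \<Longrightarrow>
      dist (v t) (U t r (v r)) < e / 4"
    using V by blast
  define N where "N = nat \<lfloor>T / \<delta>\<rfloor>"
  define p where "p i = real i * \<delta>" for i
  have p: "p i \<in> {0..T}" if "i \<le> N" for i
  proof -
    have "real i \<le> T / \<delta>"
      using that T_pos \<open>0 < \<delta>\<close> unfolding N_def by (simp add: le_nat_iff le_floor_iff)
    then show ?thesis using \<open>0 < \<delta>\<close> by (simp add: p_def pos_le_divide_eq)
  qed
  have "\<exists>K. finite K \<and> (\<forall>v\<in>V. \<exists>y\<in>K. dist (v (p i)) y < \<eta>)" if "i \<le> N" for i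
    by (rule almost_orbits_totally_bounded_at[where V = V and \<sigma> = \<sigma>])
      (fact \<sigma> V V0 bdd p[OF that] \<open>0 < \<eta>\<close>)+
  then obtain K where K: "\<And>i. i \<le> N \<Longrightarrow> finite (K i)"
    "\<And>i v. i \<le> N \<Longrightarrow> v \<in> V \<Longrightarrow> \<exists>y\<in>K i. dist (v (p i)) y < \<eta>"
    by metis
  define c where "c v i = (SOME y. y \<in> K i \<and> dist (v (p i)) y < \<eta>)" for v i
  have c: "c v i \<in> K i \<and> dist (v (p i)) (c v i) < \<eta>" if "i \<le> N" "v \<in> V" for i v
    unfolding c_def using K(2)[OF that] by (intro someI_ex[of "\<lambda>y. y \<in> K i \<and> dist (v (p i)) y < \<eta>"]) blast
  \<comment> \<open>The code of \<open>v\<close>; restricting it to the grid indices makes the set of codes finite.\<close>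
  define \<phi> where "\<phi> v = restrict (c v) {..N}" for v
  have "\<phi> ` V \<subseteq> Pi\<^sub>E {..N} K"
    unfolding \<phi>_def using c by (intro image_subsetI) (simp add: restrict_PiE_iff)
  moreover have "finite (Pi\<^sub>E {..N} K)"
    using K(1) by (intro finite_PiE) auto
  ultimately have "finite (\<phi> ` V)"
    by (rule finite_subset)
  from finite_subset_image[OF this subset_refl]
  obtain W where W: "W \<subseteq> V" "finite W" "\<phi> ` V = \<phi> ` W"
    by blast
  have "\<exists>w\<in>W. \<forall>t\<in>{0..T}. dist (v t) (w t) \<le> e" if v: "v \<in> V" for v
  proof -
    obtain w where w: "w \<in> W" "\<phi> v = \<phi> w"
      using W(3) v by blast
    have "dist (v t) (w t) \<le> e" if t: "t \<in> {0..T}" for t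
    proof -
      define i where "i = nat \<lfloor>t / \<delta>\<rfloor>"
      have iN: "i \<le> N"
        using t \<open>0 < \<delta>\<close> unfolding i_def N_def by (intro nat_mono floor_mono divide_right_mono) auto
      have "real i \<le> t / \<delta>" "t / \<delta> < real i + 1"
        using t \<open>0 < \<delta>\<close> floor_correct[of "t / \<delta>"] unfolding i_def by (simp_all add: of_nat_nat)
      then have ti: "p i \<le> t" "t - p i < \<delta>"
        using \<open>0 < \<delta>\<close> by (simp_all add: p_def pos_le_divide_eq pos_divide_less_eq algebra_simps)
      have wV: "w \<in> V" using w W by blast
      have "c v i = c w i"
        using fun_cong[OF w(2), of i] iN by (simp add: \<phi>_def)
      then have "dist (v (p i)) (w (p i)) < 2 * \<eta>"
        using c[OF iN v] c[OF iN wV] dist_triangle2[of "v (p i)" "w (p i)" "c v i"] by simp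
      have pi: "0 \<le> p i" "p i \<le> t" "t \<le> T"
        using p[OF iN] ti t by auto
      have "dist (U t (p i) (v (p i))) (U t (p i) (w (p i))) =
          norm (U t (p i) (v (p i) - w (p i)))"
        by (simp add: dist_norm linear_diff[OF bounded_linear.linear[OF bounded_linear_U[OF pi]]])
      also have "\<dots> \<le> C * norm (v (p i) - w (p i))"
        by (rule norm_U_le[OF pi])
      also have "\<dots> \<le> C * (2 * \<eta>)"
        using \<open>dist (v (p i)) (w (p i)) < 2 * \<eta>\<close> C_ge_1 by (intro mult_left_mono) (auto simp: dist_norm)
      also have "\<dots> = e / 2"
        using C_ge_1 by (simp add: \<eta>_def)
      finally have "dist (U t (p i) (v (p i))) (U t (p i) (w (p i))) \<le> e / 2" .
      then show ?thesis
        using \<delta>[OF v pi ti(2)] \<delta>[OF wV pi ti(2)]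
          dist_triangle[of "v t" "w t" "U t (p i) (v (p i))"]
          dist_triangle2[of "U t (p i) (v (p i))" "w t" "U t (p i) (w (p i))"] by linarith
    qed
    with w(1) show ?thesis by blast
  qed
  with W show ?thesis by blast
qed

end

section \<open>Relative compactness of continuous functions in the piecewise continuous ones\<close>

lemma continuous_extensional_in_PC:
  assumes "continuous_on {0..T} x" "x \<in> extensional {0..T}" "\<tau> ` {1..m} \<subseteq> {0<..<T}"
  shows "x \<in> PC T \<tau> m"
proof -
  have "isCont x (\<tau> k)" if "k \<in> {1..m}" for k
  proof (rule continuous_on_interior[OF assms(1)])
    have "\<tau> k \<in> {0<..<T}" using assms(3) that by blast
    then show "\<tau> k \<in> interior {0..T}" by simp
  qed
  then have "(x \<longlongrightarrow> x (\<tau> k)) (at_left (\<tau> k)) \<and> (x \<longlongrightarrow> x (\<tau> k)) (at_right (\<tau> k))" if "k \<in> {1..m}" for k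
    using that by (auto simp: isCont_def filterlim_at_split)
  then show ?thesis
    unfolding PC_def using assms continuous_on_subset[OF assms(1)] by blast
qed

text \<open>
  The closure of \<open>S\<close> is first taken among the continuous functions, a complete space. There it is
  compact, and it stays compact, hence closed, in the larger space \<open>PC\<close>, so it contains the closure
  of \<open>S\<close> in \<open>PC\<close>.
\<close>

lemma relatively_compactin_PC_metric:
  fixes S :: "(real \<Rightarrow> 'a::banach) set"
  assumes \<tau>: "\<tau> ` {1..m} \<subseteq> {0<..<T}"
    and S: "\<And>x. x \<in> S \<Longrightarrow> continuous_on {0..T} x \<and> x \<in> extensional {0..T}"
    and tb: "\<And>e. 0 < e \<Longrightarrow>
      \<exists>W. finite W \<and> W \<subseteq> S \<and> (\<forall>x\<in>S. \<exists>w\<in>W. \<forall>t\<in>{0..T}. dist (x t) (w t) \<le> e)"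
  shows "relatively_compactin (mtopology_of (PC_metric T \<tau> m)) S"
proof -
  let ?F = "funspace {0..T} (euclidean_metric :: 'a metric)"
  let ?C = "cfunspace (top_of_set {0..T}) (euclidean_metric :: 'a metric)"
  let ?P = "PC_metric T \<tau> m :: (real \<Rightarrow> 'a) metric"
  have C: "?C = submetric ?F {x. continuous_on {0..T} x}"
    by (simp add: cfunspace_def)
  have C_eq: "mspace ?C = {x. continuous_on {0..T} x \<and> x \<in> extensional {0..T}}"
    by (auto simp: compact_continuous_image intro!: compact_imp_bounded)
  have C_PC: "mspace ?C \<subseteq> PC T \<tau> m"
    unfolding C_eq using continuous_extensional_in_PC[OF _ _ \<tau>] by blast
  have SC: "S \<subseteq> mspace ?C"
    unfolding C_eq using S by blast
  interpret C: Metric_space "mspace ?C" "mdist ?C"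
    by (rule Metric_space_mspace_mdist)
  have euclidean: "Met_TC.Self = (euclidean_metric :: 'a metric)"
    by (simp add: Met_TC.Self_def euclidean_metric_def)
  have "Met_TC.mcomplete TYPE('a)"
    by (simp add: complete_UNIV)
  from Met_TC.mcomplete_cfunspace[OF this, unfolded euclidean] have "C.mcomplete"
    unfolding mcomplete_of_def .
  moreover have "C.mtotally_bounded S"
    unfolding C.mtotally_bounded_def
  proof (intro allI impI)
    fix e :: real assume "0 < e"
    then obtain W where W: "finite W" "W \<subseteq> S" "\<forall>x\<in>S. \<exists>w\<in>W. \<forall>t\<in>{0..T}. dist (x t) (w t) \<le> e / 2"
      using tb[of "e / 2"] by auto
    have "x \<in> (\<Union>w\<in>W. C.mball w e)" if x: "x \<in> S" for x
    proof -
      obtain w where w: "w \<in> W" "\<forall>t\<in>{0..T}. dist (x t) (w t) \<le> e / 2"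
        using W(3) x by blast
      have "mdist ?C w x \<le> e / 2"
        using w(2) \<open>0 < e\<close> by (intro mdist_cfunspace_le) (auto simp: dist_commute)
      then show ?thesis
        using w(1) x W(2) SC \<open>0 < e\<close> by (intro UN_I[OF w(1)]) (auto simp: C.in_mball simp del: mspace_cfunspace)
    qed
    with W show "\<exists>K. finite K \<and> K \<subseteq> S \<and> S \<subseteq> (\<Union>x\<in>K. C.mball x e)"
      by (intro exI[of _ W]) auto
  qed
  ultimately have K: "compactin (mtopology_of ?C) (mtopology_of ?C closure_of S)" (is "compactin _ ?K")
    using C.mtotally_bounded_eq_compact_closure_of by (simp add: mtopology_of_def)
  have "?K \<subseteq> mspace ?C"
    by (metis closure_of_subset_topspace topspace_mtopology_of)
  then have "?K \<subseteq> PC T \<tau> m"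
    using C_PC by blast
  with K have K': "compactin (mtopology_of ?P) ?K"
    unfolding C PC_metric_def mtopology_of_submetric compactin_subtopology by simp
  have "S \<subseteq> ?K"
    using SC by (intro closure_of_subset) simp
  moreover have "closedin (mtopology_of ?P) ?K"
    by (rule compactin_imp_closedin[OF _ K']) (simp add: mtopology_of_def Metric_space.Hausdorff_space_mtopology)
  ultimately have "mtopology_of ?P closure_of S \<subseteq> ?K"
    by (rule closure_of_minimal)
  then have "compactin (mtopology_of ?P) (mtopology_of ?P closure_of S)"
    using closed_compactin[OF K'] by simp
  moreover have "S \<subseteq> topspace (mtopology_of ?P)"
    using SC C_PC by (simp add: mspace_PC_metric del: mspace_cfunspace)
  ultimately show ?thesis
    by (simp add: relatively_compactin_def)
qed

section \<open>Compactness of the generated evolution family and the theorem\<close>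

text \<open>
  Since \<open>U(t,s) x\<close> lies in the domain of \<open>A(t)\<close>, it is the resolvent applied to
  \<open>z U(t,s) x - A(t) U(t,s) x\<close>, which is \<open>f x\<close> in the proof. This is bounded for bounded \<open>x\<close>, as
  \<open>A(t) U(t,s)\<close> is a bounded operator for \<open>s < t\<close>, and the resolvent is compact.
\<close>

lemma generated_evolution_family_compact:
  assumes gen: "generated_evolution_family T D A U" and R4: "cond_R4 T D A"
    and st: "0 \<le> s" "s < t" "t \<le> T" and S: "bounded S"
  shows "compact (closure (U t s ` S))"
proof -
  obtain z where z: "z \<in> resolvent_set (D t) (A t)" "compact_operator (resolvent (D t) (A t) z)"
    using bspec[OF R4[unfolded cond_R4_def], of t] st by auto
  have "range (U t s) \<subseteq> D t"
    using gen st by (simp add: generated_evolution_family_def)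
  then have dom: "U t s x \<in> D t" for x
    by blast
  have U: "bounded_linear (U t s)"
    using gen st by (simp add: generated_evolution_family_def evolution_family_def bounded_clinear_def)
  have AU: "bounded_linear (\<lambda>x. A t (U t s x))"
    using gen st by (auto simp: generated_evolution_family_def bounded_clinear_def o_def)
  define f where "f x = z *\<^sub>C U t s x - A t (U t s x)" for x
  have "resolvent (D t) (A t) z (f x) = U t s x" for x
    unfolding resolvent_def inv_operator_def f_def
    using z(1) dom inv_into_f_f[of "\<lambda>x. z *\<^sub>C x - A t x" "D t" "U t s x"]
    by (simp add: resolvent_set_def bij_betw_def)
  then have "U t s ` S = resolvent (D t) (A t) z ` f ` S"
    by (simp add: image_image)
  moreover have "bounded (f ` S)"
  proof -
    obtain b where b: "\<And>x. x \<in> U t s ` S \<Longrightarrow> norm x \<le> b"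
      using bounded_linear_image[OF S U] by (auto simp: bounded_iff)
    obtain c where c: "\<And>x. x \<in> (\<lambda>x. A t (U t s x)) ` S \<Longrightarrow> norm x \<le> c"
      using bounded_linear_image[OF S AU] by (auto simp: bounded_iff)
    have "norm (f x) \<le> norm z * b + c" if "x \<in> S" for x
    proof -
      have "norm (f x) \<le> norm z * norm (U t s x) + norm (A t (U t s x))"
        unfolding f_def using norm_triangle_ineq4[of "z *\<^sub>C U t s x"] by (simp add: norm_scaleC)
      also have "\<dots> \<le> norm z * b + c"
        using b c that by (intro add_mono mult_left_mono) auto
      finally show ?thesis .
    qed
    then show ?thesis by (auto simp: bounded_iff)
  qed
  ultimately show ?thesis
    using z(2) by (simp add: compact_operator_def)
qed

theorem lemma3p6:
  fixes T :: real and \<tau> :: "nat \<Rightarrow> real" and m :: nat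
    and D :: "real \<Rightarrow> 'a::complex_banach set" and A :: "real \<Rightarrow> 'a \<Rightarrow> 'a"
    and U :: "real \<Rightarrow> real \<Rightarrow> 'a \<Rightarrow> 'a"
    and h :: "nat \<Rightarrow> real \<Rightarrow> 'a"
  assumes "0 < T"
    and "strict_mono_on {1..m} \<tau>" and "\<tau> ` {1..m} \<subseteq> {0<..<T}"
    and "cond_R1 T D A" and "cond_R2 T D A" and "cond_R3 T D A" and "cond_R4 T D A"
    and "generated_evolution_family T D A U"
    and "\<forall>n. h n \<in> L1_functions T"
    and "integrably_bounded T h"
  shows "relatively_compactin (mtopology_of (PC_metric T \<tau> m))
           (range (\<lambda>n. convolution_operator T U (h n)))"
proof -
  let ?v = "\<lambda>n. convolution_operator T U (h n)"
  obtain \<sigma> where \<sigma>: "integrable (lebesgue_on {0..T}) \<sigma>" "\<forall>t\<in>{0..T}. 0 \<le> \<sigma> t"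
    "AE t in lebesgue_on {0..T}. \<forall>n. norm (h n t) \<le> \<sigma> t"
    using assms(10) unfolding integrably_bounded_def by blast
  obtain C where C: "1 \<le> C" "\<And>s t. 0 \<le> s \<Longrightarrow> s \<le> t \<Longrightarrow> t \<le> T \<Longrightarrow> onorm (U t s) \<le> C"
    using assms(8) unfolding generated_evolution_family_def by auto
  have ev: "evolution_family T U"
    using assms(8) by (simp add: generated_evolution_family_def)
  interpret compact_evolution_family T C U
    by standard (fact assms(1) ev C generated_evolution_family_compact[OF assms(8,7)])+
  have forcing: "dominated_forcing T C U (h n) \<sigma>" for n
  proof
    show "strongly_measurable (lebesgue_on {0..T}) (h n)"
      using assms(9) by (simp add: L1_functions_def strong_bochner_integrable_def)
    show "AE s in lebesgue_on {0..T}. norm (h n s) \<le> \<sigma> s"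
      using \<sigma>(3) by eventually_elim blast
  qed (use \<sigma> in auto)
  have \<sigma>_int: "\<sigma> integrable_on {0..T}"
    by (rule dominated_forcing.\<sigma>_integrable_on[OF forcing]) auto
  have orbit: "almost_orbit \<sigma> (?v n)" for n
    unfolding almost_orbit_def dist_norm
    using dominated_forcing.norm_mild_diff_le[OF forcing] by blast
  show ?thesis
  proof (rule relatively_compactin_PC_metric[OF assms(3)])
    show "continuous_on {0..T} x \<and> x \<in> extensional {0..T}" if "x \<in> range ?v" for x
      using that continuous_on_almost_orbit[OF \<sigma>_int orbit]
      by (auto simp: convolution_operator_def)
    show "\<exists>W. finite W \<and> W \<subseteq> range ?v \<and>
        (\<forall>x\<in>range ?v. \<exists>w\<in>W. \<forall>t\<in>{0..T}. dist (x t) (w t) \<le> e)" if "0 < e" for e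
    proof (rule almost_orbits_totally_bounded[OF \<sigma>_int _ _ _ that])
      show "almost_orbit \<sigma> v" if "v \<in> range ?v" for v
        using that orbit by blast
      show "v 0 = 0" if "v \<in> range ?v" for v
        using that dominated_forcing.mild_0[OF forcing] by blast
      show "bounded ((\<lambda>v. v r) ` range ?v)" if "r \<in> {0..T}" for r
        unfolding bounded_iff using that dominated_forcing.norm_mild_le[OF forcing]
        by (intro exI[of _ "C * integral {0..r} \<sigma>"]) auto
    qed
  qed
qed

end
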